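(* In the setting below, the intersection of the image of the map $\partial_3$ with $\operatorname{Span}\{\phi_1,\phi_2,\phi_3,\phi_4\}$ has dimension at most $2$. Consequently, the dimension of $\operatorname{Span}\{\phi_1,\phi_2,\phi_3,\phi_4\}$ modulo the image of $\partial_3$ is at least $2$; that is, one can choose two functions in $\operatorname{Span}\{\phi_1,\phi_2,\phi_3,\phi_4\}$ spanning a $2$-dimensional subspace of the cokernel of $\partial_3$.
   Context: Setting: $A=(a_{ij})$ is a $d\times n$ integer matrix of rank $d$, $n-d=2$, columns in $\{1\}\times\mathbb{Z}^{d-1}$ spanning $\mathbb{Z}^d$; $H_A(\beta')$ is the left ideal of the Weyl algebra generated by $\partial^u-\partial^{u'}$ ($u,u'\in\mathbb{N}^n$, $Au=Au'$) and $\sum_j a_{ij}x_j\partial_j-\beta'_i$; solutions are holomorphic solutions near a generic point. $B=(b_{ji})$ is $n\times2$ with columns $B_1,B_2$ a $\mathbb{Z}$-basis of $\ker_{\mathbb{Z}}(A)$, $b_{11},b_{12}>0$, $b_{21}<0<b_{22}$, $b_{31},b_{32}<0$, $b_{41}>0>b_{42}$, and if rows 2, 4 of $B$ are linearly independent then $\{z\in\mathbb{R}^2:(Bz)_2\ge0,(Bz)_4\ge0\}$ lies in the first quadrant. $\alpha_5,\dots,\alpha_n\in\mathbb{C}\setminus\mathbb{Q}$ with $\alpha_i\notin\mathbb{Q}(\alpha_j:j\ge5,j\ne i)$; $v=B_{1+}+B_{2+}-e_1-e_2-e_4+\sum_{i\ge5}\alpha_ie_i$, $(u_+)_l=\max(u_l,0)$,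 $u_-=u_+-u$; $\beta=A(v-e_3)$. $\partial_3$ is the linear map $\psi\mapsto\partial\psi/\partial x_3$ from the solution space of $H_A(A\cdot v)$ to that of $H_A(\beta)$. $\phi_1=\phi_{v-e_3-B_1-B_2}$, $\phi_2=\phi_{v-e_3-B_2}$, $\phi_3=\phi_{v-e_3}$, $\phi_4=\phi_{v-e_3-B_1}$, where for $u$ with minimum negative support (for all $v'\in\ker_{\mathbb{Z}}A$, $\operatorname{nsupp}(u+v')\subseteq\operatorname{nsupp}(u)$ implies equality; $\operatorname{nsupp}(u)=\{i:u_i\in\mathbb{Z}_{<0}\}$), $\phi_u=\sum_{v'\in N_u}\frac{[u]_{v'_-}}{[v'+u]_{v'_+}}x^{u+v'}$, $N_u=\{v'\in\ker_{\mathbb{Z}}A:\operatorname{nsupp}(u+v')=\operatorname{nsupp}(u)\}$, $[u]_{v'_-}=\prod_{i:v'_i<0}\prod_{j=1}^{-v'_i}(u_i-j+1)$, $[v'+u]_{v'_+}=\prod_{i:v'_i>0}\prod_{j=1}^{v'_i}(u_i+j)$; these are solutions of $H_A(\beta)$. *)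

theory Defs
  imports "HOL-Analysis.Analysis" "HOL-Library.Function_Algebras"
begin

section \<open>Complex vector spaces of functions\<close>

definition cscale :: "complex \<Rightarrow> ('a \<Rightarrow> complex) \<Rightarrow> 'a \<Rightarrow> complex" where
  "cscale c f = (\<lambda>x. c * f x)"

global_interpretation cfun: vector_space "cscale :: complex \<Rightarrow> ('a \<Rightarrow> complex) \<Rightarrow> 'a \<Rightarrow> complex"
  by unfold_locales (auto simp: cscale_def fun_eq_iff algebra_simps)

text \<open>Dimension of the image of \<open>V\<close> in the quotient by the subspace \<open>W\<close>, as the least number
  of elements of \<open>V\<close> that generate \<open>V\<close> modulo \<open>W\<close> (meaningful for finite-dimensional \<open>V\<close>).\<close>

definition dim_mod :: "('a \<Rightarrow> complex) set \<Rightarrow> ('a \<Rightarrow> complex) set \<Rightarrow> nat" where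
  "dim_mod V W = (LEAST k. \<exists>T. finite T \<and> card T = k \<and> T \<subseteq> V \<and> V \<subseteq> cfun.span (T \<union> W))"


section \<open>Holomorphic functions of several variables\<close>

definition mholomorphic_on :: "(complex^'n \<Rightarrow> complex) \<Rightarrow> (complex^'n) set \<Rightarrow> bool"
  (infixl \<open>mholomorphic'_on\<close> 50) where
  "f mholomorphic_on U \<longleftrightarrow>
     (\<forall>x\<in>U. \<exists>f'. (f has_derivative f') (at x) \<and> (\<forall>c h. f' (c *s h) = c * f' h))"

definition pd :: "'n::finite \<Rightarrow> (complex^'n \<Rightarrow> complex) \<Rightarrow> complex^'n \<Rightarrow> complex" where
  "pd j f x = deriv (\<lambda>t. f (x + axis j t)) 0"

text \<open>The monomial \<open>\<partial>\<^sup>u\<close>, with the variables taken in an arbitrary fixed order; the order is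
  immaterial on holomorphic functions.\<close>

definition pd_monom :: "nat^'n \<Rightarrow> (complex^'n \<Rightarrow> complex) \<Rightarrow> complex^'n \<Rightarrow> complex" where
  "pd_monom u = foldr (\<lambda>j P. (pd j ^^ (u $ j)) \<circ> P)
                  (SOME xs. distinct xs \<and> set xs = (UNIV :: 'n set)) id"

text \<open>Analytic continuation of the germ of \<open>g\<close> at \<open>q\<close> to the germ of \<open>f\<close> at \<open>p\<close> along some path.\<close>

definition continues_to ::
  "(complex^'n \<Rightarrow> complex) \<Rightarrow> complex^'n \<Rightarrow> (complex^'n \<Rightarrow> complex) \<Rightarrow> complex^'n \<Rightarrow> bool" where
  "continues_to g q f p \<longleftrightarrow>
     (\<exists>\<gamma> F \<rho>. path \<gamma> \<and> pathstart \<gamma> = q \<and> pathfinish \<gamma> = p \<and>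
        (\<forall>t\<in>{0..1}. \<rho> t > 0 \<and> F t mholomorphic_on ball (\<gamma> t) (\<rho> t)) \<and>
        (\<forall>t\<in>{0..1}. \<exists>\<delta>>0. \<forall>s\<in>{0..1}. \<bar>s - t\<bar> < \<delta> \<longrightarrow>
           (\<forall>\<^sub>F x in nhds (\<gamma> s). F s x = F t x)) \<and>
        (\<forall>\<^sub>F x in nhds q. F (0::real) x = g x) \<and>
        (\<forall>\<^sub>F x in nhds p. F 1 x = f x))"


section \<open>A-hypergeometric systems\<close>

text \<open>The Weyl algebra acts faithfully on holomorphic functions, and its elements are represented
  by the operators through which they act.\<close>

inductive_set weyl :: "((complex^'n \<Rightarrow> complex) \<Rightarrow> complex^'n \<Rightarrow> complex) set" where
  const: "(\<lambda>f x. c * f x) \<in> weyl"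
| var: "(\<lambda>f x. x $ j * f x) \<in> weyl"
| pd: "pd j \<in> weyl"
| add: "P \<in> weyl \<Longrightarrow> Q \<in> weyl \<Longrightarrow> (\<lambda>f x. P f x + Q f x) \<in> weyl"
| mult: "P \<in> weyl \<Longrightarrow> Q \<in> weyl \<Longrightarrow> P \<circ> Q \<in> weyl"

inductive_set hypergeometric_ideal ::
  "int^'n^'d \<Rightarrow> complex^'d \<Rightarrow> ((complex^'n \<Rightarrow> complex) \<Rightarrow> complex^'n \<Rightarrow> complex) set"
  for A :: "int^'n^'d" and \<beta> :: "complex^'d" where
  toric: "A *v (\<chi> j. int (u $ j)) = A *v (\<chi> j. int (u' $ j)) \<Longrightarrow>
    (\<lambda>f x. pd_monom u f x - pd_monom u' f x) \<in> hypergeometric_ideal A \<beta>"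
| euler: "(\<lambda>f x. (\<Sum>j\<in>UNIV. of_int (A $ i $ j) * x $ j * pd j f x) - \<beta> $ i * f x)
    \<in> hypergeometric_ideal A \<beta>"
| add: "P \<in> hypergeometric_ideal A \<beta> \<Longrightarrow> Q \<in> hypergeometric_ideal A \<beta> \<Longrightarrow>
    (\<lambda>f x. P f x + Q f x) \<in> hypergeometric_ideal A \<beta>"
| left_mult: "P \<in> weyl \<Longrightarrow> Q \<in> hypergeometric_ideal A \<beta> \<Longrightarrow> P \<circ> Q \<in> hypergeometric_ideal A \<beta>"

text \<open>Functions on an open set \<open>U\<close> are extended by \<open>0\<close>, so that two solutions on \<open>U\<close> are equal
  iff they agree on \<open>U\<close>.\<close>

definition solutions ::
  "(complex^'n) set \<Rightarrow> int^'n^'d \<Rightarrow> complex^'d \<Rightarrow> (complex^'n \<Rightarrow> complex) set" where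
  "solutions U A \<beta> = {f. f mholomorphic_on U \<and> (\<forall>x. x \<notin> U \<longrightarrow> f x = 0) \<and>
     (\<forall>P\<in>hypergeometric_ideal A \<beta>. \<forall>x\<in>U. P f x = 0)}"

definition pd_map ::
  "(complex^'n) set \<Rightarrow> 'n::finite \<Rightarrow> (complex^'n \<Rightarrow> complex) \<Rightarrow> complex^'n \<Rightarrow> complex" where
  "pd_map U j \<psi> = (\<lambda>x. if x \<in> U then pd j \<psi> x else 0)"


section \<open>The logarithm-free series\<close>

definition cvec :: "int^'n \<Rightarrow> complex^'n" where
  "cvec u = (\<chi> l. of_int (u $ l))"

definition pos_part :: "int^'n \<Rightarrow> int^'n" where
  "pos_part u = (\<chi> l. max (u $ l) 0)"

definition nsupp :: "complex^'n \<Rightarrow> 'n set" where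
  "nsupp u = {i. \<exists>k::int. k < 0 \<and> u $ i = of_int k}"

definition same_nsupp :: "int^'n^'d \<Rightarrow> complex^'n \<Rightarrow> (int^'n) set" where
  "same_nsupp A u = {v'. A *v v' = 0 \<and> nsupp (u + cvec v') = nsupp u}"

definition phi_coeff :: "complex^'n \<Rightarrow> int^'n \<Rightarrow> complex" where
  "phi_coeff u v' =
     (\<Prod>i\<in>{i. v' $ i < 0}. \<Prod>j=1..nat (- (v' $ i)). u $ i - of_nat j + 1) /
     (\<Prod>i\<in>{i. v' $ i > 0}. \<Prod>j=1..nat (v' $ i). u $ i + of_nat j)"

text \<open>The series \<open>\<phi>\<^sub>u\<close> converges near \<open>q\<close> with sum \<open>f\<close>, for some branch \<open>L\<close> of
  \<open>(log x\<^sub>1, \<dots>, log x\<^sub>n)\<close> near \<open>q\<close>. All exponents of \<open>\<phi>\<^sub>u\<close> agree modulo \<open>\<int>\<close>, so another branch only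
  multiplies \<open>f\<close> by a nonzero constant.\<close>

definition phi_sum ::
  "int^'n^'d \<Rightarrow> complex^'n \<Rightarrow> complex^'n \<Rightarrow> (complex^'n \<Rightarrow> complex) \<Rightarrow> bool" where
  "phi_sum A u q f \<longleftrightarrow>
     (\<exists>\<epsilon>>0. \<exists>L :: complex^'n \<Rightarrow> complex^'n.
        (\<forall>j. (\<lambda>x. L x $ j) mholomorphic_on ball q \<epsilon>) \<and>
        (\<forall>x\<in>ball q \<epsilon>. \<forall>j. exp (L x $ j) = x $ j) \<and>
        (\<forall>x\<in>ball q \<epsilon>.
           ((\<lambda>v'. phi_coeff u v' * exp (\<Sum>j\<in>UNIV. (u + cvec v') $ j * L x $ j)) has_sum f x)
             (same_nsupp A u)))"

definition phi_converges :: "int^'n^'d \<Rightarrow> complex^'n \<Rightarrow> complex^'n \<Rightarrow> bool" where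
  "phi_converges A u q \<longleftrightarrow> (\<exists>g. phi_sum A u q g)"

text \<open>\<open>f\<close> is the function \<open>\<phi>\<^sub>u\<close> near \<open>p\<close>: the sum of the series if it converges there, and
  otherwise an analytic continuation of its sum from elsewhere.\<close>

definition is_phi ::
  "int^'n^'d \<Rightarrow> complex^'n \<Rightarrow> complex^'n \<Rightarrow> (complex^'n \<Rightarrow> complex) \<Rightarrow> bool" where
  "is_phi A u p f \<longleftrightarrow>
     (if phi_converges A u p then phi_sum A u p f
      else \<exists>q g. phi_sum A u q g \<and> continues_to g q f p)"


section \<open>Field extensions of the rationals inside the complex numbers\<close>

definition complex_subfield :: "complex set \<Rightarrow> bool" where
  "complex_subfield K \<longleftrightarrow> 1 \<in> K \<and> (\<forall>a\<in>K. \<forall>b\<in>K. a - b \<in> K \<and> a * b \<in> K) \<and> (\<forall>a\<in>K. inverse a \<in> K)"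

definition rat_adjoin :: "complex set \<Rightarrow> complex set" where
  "rat_adjoin S = complex_subfield hull S"

end

theory Submission
  imports Defs "HOL-Complex_Analysis.Conformal_Mappings"
begin

text \<open>
  Let \<open>w\<close> be a linear dependence between the rows \<open>1, \<dots>, 4\<close> of \<open>B\<close>; extended by \<open>0\<close>, it lies in the
  row space of \<open>A\<close>. There are monomials \<open>\<partial>\<^bsup>m\<^sub>i\<^esup>\<close> and \<open>\<partial>\<^sup>M\<close> such that every solution \<open>\<psi>\<close> of
  \<open>H\<^sub>A(A v)\<close> satisfies \<open>\<partial>\<^bsup>m\<^sub>i\<^esup> \<partial>\<^sub>3 \<psi> = \<partial>\<^sub>i \<partial>\<^sup>M \<psi>\<close> for \<open>i = 1, \<dots>, 4\<close>, and such that \<open>\<partial>\<^sup>M \<psi>\<close> has degree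
  \<open>0\<close> in the variables \<open>1, \<dots>, 4\<close>. By the Euler relations the operator
  \<open>P\<^sub>w = \<Sum>\<^sub>i w\<^sub>i x\<^sub>i \<partial>\<^bsup>m\<^sub>i\<^esup>\<close> therefore annihilates the image of \<open>\<partial>\<^sub>3\<close>. On the series, on the other
  hand, all terms but one cancel and \<open>P\<^sub>w \<phi>\<^sub>j = w\<^sub>j K\<^sub>j x\<^sup>y\<close> with \<open>K\<^sub>j \<noteq> 0\<close> and \<open>y\<close> independent of \<open>j\<close>.
  Up to a nonzero factor this survives analytic continuation, because \<open>x\<^sup>y\<close> is characterized by
  the equations \<open>x\<^sub>k \<partial>\<^sub>k h = y\<^sub>k h\<close>. The dependences form a space of dimension \<open>2\<close>, so evaluating
  \<open>P\<^sub>w\<close> at \<open>p\<close> yields two independent functionals on the span that vanish on the image of \<open>\<partial>\<^sub>3\<close>.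
\<close>


section \<open>Separately holomorphic functions\<close>

text \<open>The series are given only as pointwise sums, possibly far from \<open>p\<close>, and for
  branches of the logarithm that need not be related. Therefore the only information moved along a
  path is whether an operator in \<open>weyl\<close> kills a germ. Why a single term survives:
  differentiation multiplies a coefficient by the exponent, so the coefficient of x^(y+mu) in P_w
  phi_j is a common factor times the sum of the w_i mu_i, which vanishes because w is orthogonal to
  the kernel of A. This rule breaks down only where the one negative coordinate j passes from
  exponent 0 to -1: there the lower term may occur in the series although the upper one does not.
  The signs of the four rows of B leave just one such lattice point, mu = 0. The same signs,
  together with the entries lowered by 1 in v, ensure that no lattice translate of v - e_3 is
  nonnegative in the coordinates 1, ..., 4; hence the breakdown never disturbs the termwise
  derivatives of the series.\<close>

lemma norm_axis_complex [simp]: "norm (axis k t :: complex^'n) = norm t"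
proof -
  have "norm (axis k t :: complex^'n) = L2_set (\<lambda>i. if i = k then norm t else 0) UNIV"
    unfolding norm_vec_def by (rule L2_set_cong) (auto simp: axis_def)
  also have "\<dots> = sqrt (\<Sum>i\<in>UNIV. if i = k then (norm t)\<^sup>2 else 0)"
    unfolding L2_set_def by (intro arg_cong[where f = sqrt] sum.cong) auto
  finally show ?thesis by simp
qed

lemma axis_plus: "axis k (s + t :: complex) = axis k s + (axis k t :: complex^'n)"
  by (simp add: vec_eq_iff axis_def)

lemma axis_0_right [simp]: "axis k (0 :: complex) = (0 :: complex^'n)"
  by (simp add: vec_eq_iff axis_def)

lemma bounded_linear_axis: "bounded_linear (axis k :: complex \<Rightarrow> complex^'n)"
  by (rule bounded_linear_intro[where K = 1]) (auto simp: axis_plus, auto simp: vec_eq_iff axis_def)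

lemma continuous_on_add_axis [continuous_intros]:
  "continuous_on S (\<lambda>t. x + axis k t :: complex^'n)"
  by (intro continuous_intros linear_continuous_on bounded_linear_axis)

text \<open>Continuity plus complex differentiability along the axes passes to partial derivatives
  and to uniform limits by one-variable arguments on slices. All analysis below is done with this
  notion instead of the total derivative.\<close>

definition sep_holomorphic_on :: "(complex^'n::finite \<Rightarrow> complex) \<Rightarrow> (complex^'n) set \<Rightarrow> bool"
    (infixl \<open>sep'_holomorphic'_on\<close> 50) where
  "f sep_holomorphic_on U \<longleftrightarrow>
     continuous_on U f \<and> (\<forall>x\<in>U. \<forall>k. (\<lambda>t. f (x + axis k t)) field_differentiable at 0)"

lemma mholomorphic_imp_sep_holomorphic:
  assumes "f mholomorphic_on U"
  shows "f sep_holomorphic_on U"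
  unfolding sep_holomorphic_on_def
proof (intro conjI ballI allI)
  show "continuous_on U f"
    using assms unfolding mholomorphic_on_def
    by (intro continuous_at_imp_continuous_on) (blast intro: has_derivative_continuous)
  fix x k assume "x \<in> U"
  then obtain f' where f': "(f has_derivative f') (at x)" and lin: "\<And>c h. f' (c *s h) = c * f' h"
    using assms unfolding mholomorphic_on_def by blast
  have "((\<lambda>t. x + axis k t) has_derivative axis k) (at 0)"
    using has_derivative_add[OF has_derivative_const
        bounded_linear_imp_has_derivative[OF bounded_linear_axis[of k]], of x] by simp
  with f' have *: "((\<lambda>t. f (x + axis k t)) has_derivative (\<lambda>t. f' (axis k t))) (at 0)"
    using has_derivative_compose[of "\<lambda>t. x + axis k t" "axis k" 0 UNIV f f'] by simp
  have "f' (axis k t) = f' (axis k 1) * t" for t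
  proof -
    have "axis k t = t *s axis k 1"
      by (simp add: vec_eq_iff axis_def)
    then show ?thesis using lin[of t "axis k 1"] by (simp only: mult.commute)
  qed
  then have "(\<lambda>t. f' (axis k t)) = (*) (f' (axis k 1))"
    by (rule ext)
  with * show "(\<lambda>t. f (x + axis k t)) field_differentiable at 0"
    unfolding field_differentiable_def has_field_derivative_def by (intro exI[of _ "f' (axis k 1)"]) simp
qed

lemma sep_holomorphic_on_subset:
  "f sep_holomorphic_on U \<Longrightarrow> V \<subseteq> U \<Longrightarrow> f sep_holomorphic_on V"
  unfolding sep_holomorphic_on_def using continuous_on_subset by blast

lemma sep_holomorphic_onI:
  assumes "\<And>x. x \<in> U \<Longrightarrow> \<exists>V. open V \<and> x \<in> V \<and> f sep_holomorphic_on V"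
  shows "f sep_holomorphic_on U"
  unfolding sep_holomorphic_on_def
proof (intro conjI ballI allI)
  show "continuous_on U f"
    using assms unfolding sep_holomorphic_on_def
    by (intro continuous_at_imp_continuous_on) (metis continuous_on_eq_continuous_at)
qed (use assms sep_holomorphic_on_def in blast)

lemma has_field_derivative_slice:
  assumes "f sep_holomorphic_on U" "x + axis k t \<in> U"
  shows "((\<lambda>s. f (x + axis k s)) has_field_derivative pd k f (x + axis k t)) (at t)"
proof -
  have "(\<lambda>s. f (x + axis k t + axis k s)) field_differentiable at 0"
    using assms unfolding sep_holomorphic_on_def by blast
  then have "((\<lambda>s. f (x + axis k t + axis k s)) has_field_derivative pd k f (x + axis k t)) (at 0)"
    by (simp add: pd_def field_differentiable_derivI)
  then have "((\<lambda>s. (\<lambda>s. f (x + axis k s)) (s + t)) has_field_derivative pd k f (x + axis k t)) (at 0)"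
    by (simp add: axis_plus add_ac)
  then show ?thesis
    by (subst (asm) DERIV_shift[symmetric]) simp
qed

lemma pd_eqI: "((\<lambda>t. f (x + axis k t)) has_field_derivative D) (at 0) \<Longrightarrow> pd k f x = D"
  unfolding pd_def by (rule DERIV_imp_deriv)

lemma has_field_derivative_slice_0:
  assumes "f sep_holomorphic_on U" "x \<in> U"
  shows "((\<lambda>s. f (x + axis k s)) has_field_derivative pd k f x) (at 0)"
  using has_field_derivative_slice[of f U x k 0] assms by simp

lemma eventually_slice:
  assumes "\<forall>\<^sub>F y in nhds x. P y"
  shows "\<forall>\<^sub>F t in nhds 0. P (x + axis k (t::complex))"
proof -
  have "((\<lambda>t. x + axis k t) \<longlongrightarrow> x + axis k 0) (at (0::complex))"
    using continuous_on_add_axis[of UNIV x k] unfolding continuous_on_def by blast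
  then have "((\<lambda>t. x + axis k t) \<longlongrightarrow> x) (nhds (0::complex))"
    using tendsto_at_iff_tendsto_nhds[of "\<lambda>t. x + axis k t" 0] by simp
  then show ?thesis
    using assms unfolding filterlim_iff by blast
qed

lemma pd_cong_ev:
  assumes "\<forall>\<^sub>F y in nhds x. f y = g y"
  shows "pd k f x = pd k g x"
  unfolding pd_def by (intro deriv_cong_ev eventually_slice assms refl)

lemma eventually_nhds_nhds: "\<forall>\<^sub>F y in nhds x. P y \<Longrightarrow> \<forall>\<^sub>F y in nhds x. \<forall>\<^sub>F z in nhds y. P z"
  unfolding eventually_nhds by blast

lemma sep_holomorphic_on_cong:
  assumes "f sep_holomorphic_on U" "open U" "\<And>x. x \<in> U \<Longrightarrow> f x = g x"
  shows "g sep_holomorphic_on U"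
  unfolding sep_holomorphic_on_def
proof (intro conjI ballI allI)
  show "continuous_on U g"
    using assms continuous_on_cong[of U U f g] unfolding sep_holomorphic_on_def by simp
  fix x k assume x: "x \<in> U"
  have "\<forall>\<^sub>F y in nhds x. f y = g y"
    using assms x unfolding eventually_nhds by blast
  then have ev: "\<forall>\<^sub>F t in nhds 0. f (x + axis k t) = g (x + axis k t)"
    by (rule eventually_slice)
  have "((\<lambda>t. f (x + axis k t)) has_field_derivative pd k f x) (at 0)"
    by (rule has_field_derivative_slice_0[OF assms(1) x])
  then have "((\<lambda>t. g (x + axis k t)) has_field_derivative pd k f x) (at 0)"
    using DERIV_cong_ev[OF refl ev refl] by blast
  then show "(\<lambda>t. g (x + axis k t)) field_differentiable at 0"
    using field_differentiable_def by blast
qed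

section \<open>Closure properties and differentiation rules\<close>

lemma sep_holomorphic_add:
  "f sep_holomorphic_on U \<Longrightarrow> g sep_holomorphic_on U \<Longrightarrow> (\<lambda>x. f x + g x) sep_holomorphic_on U"
  unfolding sep_holomorphic_on_def
  by (auto intro!: continuous_intros field_differentiable_add)

lemma sep_holomorphic_mult:
  "f sep_holomorphic_on U \<Longrightarrow> g sep_holomorphic_on U \<Longrightarrow> (\<lambda>x. f x * g x) sep_holomorphic_on U"
  unfolding sep_holomorphic_on_def
  by (auto intro!: continuous_intros field_differentiable_mult)

lemma sep_holomorphic_const: "(\<lambda>x. c) sep_holomorphic_on U"
  unfolding sep_holomorphic_on_def by auto

lemma sep_holomorphic_cmult:
  "f sep_holomorphic_on U \<Longrightarrow> (\<lambda>x. c * f x) sep_holomorphic_on U"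
  by (intro sep_holomorphic_mult sep_holomorphic_const)

lemma sep_holomorphic_diff:
  "f sep_holomorphic_on U \<Longrightarrow> g sep_holomorphic_on U \<Longrightarrow> (\<lambda>x. f x - g x) sep_holomorphic_on U"
  using sep_holomorphic_add[of f U "\<lambda>x. -1 * g x"] sep_holomorphic_cmult[of g U "-1"] by simp

lemma sep_holomorphic_sum:
  "(\<And>i. i \<in> I \<Longrightarrow> f i sep_holomorphic_on U) \<Longrightarrow> (\<lambda>x. \<Sum>i\<in>I. f i x) sep_holomorphic_on U"
  by (induction I rule: infinite_finite_induct)
     (auto intro: sep_holomorphic_add sep_holomorphic_const)

lemma slice_coordinate:
  "((\<lambda>t. (x + axis k t) $ j) has_field_derivative (if j = k then 1 else 0)) (at (t::complex))"
  by (auto simp: axis_def intro!: derivative_eq_intros)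

lemma sep_holomorphic_coordinate: "(\<lambda>x. x $ j) sep_holomorphic_on U"
  unfolding sep_holomorphic_on_def field_differentiable_def
  by (intro conjI ballI allI continuous_intros) (rule exI, rule slice_coordinate)

lemma sep_holomorphic_exp:
  assumes "f sep_holomorphic_on U"
  shows "(\<lambda>x. exp (f x)) sep_holomorphic_on U"
  unfolding sep_holomorphic_on_def
proof (intro conjI ballI allI)
  show "continuous_on U (\<lambda>x. exp (f x))"
    using assms unfolding sep_holomorphic_on_def by (auto intro: continuous_intros)
  show "(\<lambda>t. exp (f (x + axis k t))) field_differentiable at 0" if "x \<in> U" for x k
    using DERIV_chain2[OF DERIV_exp has_field_derivative_slice_0[OF assms that]]
      field_differentiable_def by blast
qed

lemma sep_holomorphic_translate:
  assumes "f sep_holomorphic_on U" "\<And>x. x \<in> V \<Longrightarrow> x + a \<in> U"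
  shows "(\<lambda>x. f (x + a)) sep_holomorphic_on V"
  unfolding sep_holomorphic_on_def
proof (intro conjI ballI allI)
  show "continuous_on V (\<lambda>x. f (x + a))"
    using assms unfolding sep_holomorphic_on_def
    by (auto intro!: continuous_on_compose2[of U f] continuous_intros)
  show "(\<lambda>t. f (x + axis k t + a)) field_differentiable at 0" if "x \<in> V" for x k
  proof -
    have "(\<lambda>t. f (x + a + axis k t)) field_differentiable at 0"
      using assms that unfolding sep_holomorphic_on_def by blast
    then show ?thesis by (simp add: add_ac)
  qed
qed

lemma pd_translate: "pd k (\<lambda>x. f (x + a)) x = pd k f (x + a)"
  unfolding pd_def by (simp add: add_ac)

lemma pd_add:
  assumes "f sep_holomorphic_on U" "g sep_holomorphic_on U" "x \<in> U"
  shows "pd k (\<lambda>x. f x + g x) x = pd k f x + pd k g x"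
  by (intro pd_eqI DERIV_add has_field_derivative_slice_0[OF assms(1,3)]
      has_field_derivative_slice_0[OF assms(2,3)])

lemma pd_mult:
  assumes "f sep_holomorphic_on U" "g sep_holomorphic_on U" "x \<in> U"
  shows "pd k (\<lambda>x. f x * g x) x = pd k f x * g x + f x * pd k g x"
  using DERIV_mult[OF has_field_derivative_slice_0[OF assms(1,3), of k]
      has_field_derivative_slice_0[OF assms(2,3), of k]]
  by (intro pd_eqI) (simp add: mult.commute)

lemma pd_const: "pd k (\<lambda>x. c) x = 0"
  by (rule pd_eqI) auto

lemma pd_cmult:
  assumes "f sep_holomorphic_on U" "x \<in> U"
  shows "pd k (\<lambda>x. c * f x) x = c * pd k f x"
  using pd_mult[OF sep_holomorphic_const assms] by (simp add: pd_const)

lemma pd_diff: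
  assumes "f sep_holomorphic_on U" "g sep_holomorphic_on U" "x \<in> U"
  shows "pd k (\<lambda>x. f x - g x) x = pd k f x - pd k g x"
  by (intro pd_eqI DERIV_diff has_field_derivative_slice_0[OF assms(1,3)]
      has_field_derivative_slice_0[OF assms(2,3)])

lemma pd_sum:
  assumes "\<And>i. i \<in> I \<Longrightarrow> f i sep_holomorphic_on U" "x \<in> U"
  shows "pd k (\<lambda>x. \<Sum>i\<in>I. f i x) x = (\<Sum>i\<in>I. pd k (f i) x)"
  by (intro pd_eqI DERIV_sum has_field_derivative_slice_0[OF assms])

lemma pd_coordinate: "pd k (\<lambda>x. x $ j) x = (if j = k then 1 else 0)"
  by (rule pd_eqI) (rule slice_coordinate)

lemma pd_exp:
  assumes "f sep_holomorphic_on U" "x \<in> U"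
  shows "pd k (\<lambda>x. exp (f x)) x = exp (f x) * pd k f x"
  by (rule pd_eqI)
     (use DERIV_chain2[OF DERIV_exp has_field_derivative_slice_0[OF assms, of k]] in simp)


section \<open>Difference quotients and uniform limits\<close>

text \<open>Taylor's formula of first order, with the second derivative bounded by Cauchy's
  inequality on circles of radius \<open>\<rho> / 4\<close> around points of the disc of radius
  \<open>\<rho> / 2\<close>. The constant depends only on \<open>B\<close> and
  \<open>\<rho>\<close>, so it serves all slices at once.\<close>

lemma difference_quotient_bound:
  fixes g :: "complex \<Rightarrow> complex"
  assumes hol: "g holomorphic_on ball 0 \<rho>" and B: "\<And>z. z \<in> ball 0 \<rho> \<Longrightarrow> norm (g z) \<le> B"
    and \<rho>: "\<rho> > 0" and t: "t \<noteq> 0" "norm t < \<rho> / 2"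
  shows "norm ((g t - g 0) / t - deriv g 0) \<le> 2 * B / (\<rho> / 4) ^ 2 * norm t"
proof -
  define S where "S = ball (0::complex) (\<rho> / 2)"
  have bd: "norm ((deriv ^^ 2) g w) \<le> fact 2 * B / (\<rho> / 4) ^ 2" if w: "w \<in> S" for w
  proof (rule Cauchy_inequality)
    have "cball w (\<rho> / 4) \<subseteq> ball 0 \<rho>"
    proof
      fix z assume "z \<in> cball w (\<rho> / 4)"
      then have "dist 0 z < \<rho>"
        using w dist_triangle[of 0 z w] \<rho> unfolding S_def by simp
      then show "z \<in> ball 0 \<rho>" by simp
    qed
    then show "g holomorphic_on ball w (\<rho> / 4)" "continuous_on (cball w (\<rho> / 4)) g"
      using hol ball_subset_cball
      by (meson holomorphic_on_subset order.trans, meson holomorphic_on_imp_continuous_on holomorphic_on_subset)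
    show "norm (g x) \<le> B" if "norm (w - x) = \<rho> / 4" for x
      using that \<open>cball w (\<rho> / 4) \<subseteq> ball 0 \<rho>\<close> by (intro B) (auto simp: subset_eq dist_norm)
  qed (use \<rho> in auto)
  have sub: "S \<subseteq> ball 0 \<rho>" and op: "open S" using \<rho> by (auto simp: S_def)
  have "norm (((deriv ^^ 0) g) t - (\<Sum>i\<le>1. ((deriv ^^ i) g) 0 * (t - 0) ^ i / fact i))
          \<le> (2 * B / (\<rho> / 4) ^ 2) * norm (t - 0) ^ (Suc 1) / fact 1"
  proof (rule complex_Taylor[where S = S])
    show "((deriv ^^ i) g has_field_derivative (deriv ^^ Suc i) g x) (at x within S)"
      if "x \<in> S" "i \<le> 1" for i x
    proof -
      have "(deriv ^^ i) g holomorphic_on ball 0 \<rho>"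
        by (rule holomorphic_higher_deriv[OF hol]) simp
      then have "((deriv ^^ i) g has_field_derivative deriv ((deriv ^^ i) g) x) (at x)"
        using that sub by (intro holomorphic_derivI[of _ "ball 0 \<rho>"]) auto
      then show ?thesis
        using has_field_derivative_at_within by simp
    qed
    show "norm ((deriv ^^ Suc 1) g x) \<le> 2 * B / (\<rho> / 4) ^ 2" if "x \<in> S" for x
      using bd[OF that] by (simp add: numeral_2_eq_2)
  qed (use \<rho> t in \<open>auto simp: S_def\<close>)
  then have *: "norm (g t - (g 0 + deriv g 0 * t)) \<le> 2 * B / (\<rho> / 4) ^ 2 * norm t ^ 2"
    by (simp add: numeral_2_eq_2)
  have "norm ((g t - g 0) / t - deriv g 0) = norm (g t - (g 0 + deriv g 0 * t)) / norm t"
    using t by (simp add: norm_divide[symmetric] field_simps)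
  also have "\<dots> \<le> (2 * B / (\<rho> / 4) ^ 2 * norm t ^ 2) / norm t"
    using * by (intro divide_right_mono) auto
  finally show ?thesis
    using t by (simp add: power2_eq_square)
qed

lemma slice_holomorphic_on:
  assumes f: "f sep_holomorphic_on U" and S: "\<And>t. t \<in> S \<Longrightarrow> x + axis k t \<in> U"
  shows "(\<lambda>t. f (x + axis k t)) holomorphic_on S"
  unfolding holomorphic_on_def
  using has_field_derivative_slice[OF f S] field_differentiable_at_within field_differentiable_def
  by blast

lemma add_axis_in_ball:
  assumes "x \<in> ball (x0 :: complex^'n) a" "norm t \<le> b"
  shows "x + axis k t \<in> ball x0 (a + b)"
proof -
  have "dist x0 (x + axis k t) \<le> dist x0 x + dist x (x + axis k t)"
    by (rule dist_triangle)
  also have "dist x (x + axis k t) = norm t"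
    by (simp add: dist_norm)
  finally show ?thesis using assms by simp
qed

text \<open>By compactness \<open>f\<close> is bounded on a closed ball of radius
  \<open>2 * \<rho>\<close>, which contains the discs of radius \<open>\<rho>\<close> in the slices
  through the smaller ball. One error bound thus holds for all of these slices.\<close>

lemma uniform_limit_difference_quotient:
  fixes f :: "complex^'n::finite \<Rightarrow> complex"
  assumes f: "f sep_holomorphic_on U" and U: "open U" "x0 \<in> U"
  obtains \<rho> h where "\<rho> > 0" "ball x0 (2 * \<rho>) \<subseteq> U" "\<And>n. h n \<noteq> 0" "\<And>n. norm (h n) < \<rho>" "h \<longlonglongrightarrow> 0"
    "uniform_limit (ball x0 \<rho>) (\<lambda>n x. (f (x + axis k (h n)) - f x) / h n) (pd k f) sequentially"
proof -
  obtain e where e: "e > 0" "cball x0 e \<subseteq> U"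
    using U open_contains_cball by metis
  define \<rho> where "\<rho> = e / 2"
  have \<rho>: "\<rho> > 0" "cball x0 (2 * \<rho>) \<subseteq> U" using e by (auto simp: \<rho>_def)
  have "compact (f ` cball x0 (2 * \<rho>))"
    using f \<rho>(2) continuous_on_subset unfolding sep_holomorphic_on_def
    by (intro compact_continuous_image compact_cball) blast
  then obtain B where B: "\<And>x. x \<in> cball x0 (2 * \<rho>) \<Longrightarrow> norm (f x) \<le> B"
    by (meson bounded_iff compact_imp_bounded imageI)
  \<comment> \<open>The factor 1/3 keeps every increment below \<open>\<rho> / 2\<close>, the range
    in which \<open>difference_quotient_bound\<close> applies.\<close>
  define h :: "nat \<Rightarrow> complex" where "h n = of_real (\<rho> / 3) / of_nat (Suc n)" for n
  have h_norm: "norm (h n) = \<rho> / 3 / real (Suc n)" for n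
    using \<rho> by (simp add: h_def norm_divide del: of_nat_Suc)
  have h_lt: "norm (h n) < \<rho> / 2" for n
  proof -
    have "\<rho> / 3 / real (Suc n) \<le> \<rho> / 3"
      using \<rho> by (simp add: field_simps)
    then show ?thesis using h_norm \<rho> by simp
  qed
  have h_0: "h \<longlonglongrightarrow> 0"
    unfolding h_def by (rule LIMSEQ_Suc[OF lim_const_over_n])
  have h_nz: "h n \<noteq> 0" for n
    using \<rho> by (simp add: h_def del: of_nat_Suc)
  define C where "C = 2 * B / (\<rho> / 4) ^ 2"
  have bound: "norm ((f (x + axis k (h n)) - f x) / h n - pd k f x) \<le> C * norm (h n)"
    if x: "x \<in> ball x0 \<rho>" for x n
  proof -
    have in_ball: "x + axis k t \<in> ball x0 (2 * \<rho>)" if "t \<in> ball 0 \<rho>" for t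
      using add_axis_in_ball[OF x, of t \<rho> k] that by (simp add: less_imp_le)
    have "norm (((\<lambda>t. f (x + axis k t)) (h n) - (\<lambda>t. f (x + axis k t)) 0) / h n
        - deriv (\<lambda>t. f (x + axis k t)) 0) \<le> C * norm (h n)"
      unfolding C_def
    proof (rule difference_quotient_bound)
      show "(\<lambda>t. f (x + axis k t)) holomorphic_on ball 0 \<rho>"
        by (rule slice_holomorphic_on[OF f]) (use in_ball \<rho> ball_subset_cball in blast)
      show "norm (f (x + axis k z)) \<le> B" if "z \<in> ball 0 \<rho>" for z
        using in_ball[OF that] by (intro B) auto
    qed (use \<rho> h_nz h_lt in auto)
    then show ?thesis by (simp add: pd_def)
  qed
  have "uniform_limit (ball x0 \<rho>) (\<lambda>n x. (f (x + axis k (h n)) - f x) / h n) (pd k f) sequentially"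
  proof (rule uniform_limitI)
    fix e :: real assume "e > 0"
    have "(\<lambda>n. C * norm (h n)) \<longlonglongrightarrow> C * 0"
      using h_0 by (intro tendsto_intros) (auto simp: tendsto_norm_zero)
    then have "\<forall>\<^sub>F n in sequentially. C * norm (h n) < e"
      using \<open>e > 0\<close> by (simp add: order_tendsto_iff)
    then show "\<forall>\<^sub>F n in sequentially. \<forall>x\<in>ball x0 \<rho>.
        dist ((f (x + axis k (h n)) - f x) / h n) (pd k f x) < e"
      unfolding dist_norm by eventually_elim (blast intro: le_less_trans[OF bound])
  qed
  moreover have "norm (h n) < \<rho>" for n using h_lt[of n] \<rho> by simp
  ultimately show thesis
    using that[of \<rho> h] \<rho> h_0 h_nz order.trans[OF ball_subset_cball \<rho>(2)] by simp
qed

text \<open>The Weierstrass theorem in one variable, applied to the slice through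
  \<open>x\<close>.\<close>

lemma slice_uniform_limit:
  fixes g :: "'i \<Rightarrow> complex^'n::finite \<Rightarrow> complex"
  assumes lim: "uniform_limit V g G F" and F: "F \<noteq> bot" and V: "open V" "x \<in> V"
    and g: "\<forall>\<^sub>F n in F. g n sep_holomorphic_on V"
  shows "(\<lambda>t. G (x + axis k t)) field_differentiable at 0" "((\<lambda>n. pd k (g n) x) \<longlongrightarrow> pd k G x) F"
proof -
  obtain e where e: "e > 0" "ball x e \<subseteq> V" using V open_contains_ball by metis
  define r where "r = e / 2"
  have inV: "x + axis k t \<in> V" if "t \<in> cball 0 r" for t
    using that e by (intro subsetD[OF e(2)]) (auto simp: r_def dist_norm)
  have ul: "uniform_limit (cball 0 r) (\<lambda>n t. g n (x + axis k t)) (\<lambda>t. G (x + axis k t)) F"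
    using lim inV unfolding uniform_limit_iff by (smt (verit, best) eventually_mono)
  have cont: "\<forall>\<^sub>F n in F. continuous_on (cball 0 r) (\<lambda>t. g n (x + axis k t)) \<and>
     (\<forall>w\<in>ball 0 r. ((\<lambda>t. g n (x + axis k t)) has_field_derivative pd k (g n) (x + axis k w)) (at w))"
    using g
  proof (eventually_elim, intro conjI ballI)
    fix n assume gn: "g n sep_holomorphic_on V"
    show "continuous_on (cball 0 r) (\<lambda>t. g n (x + axis k t))"
      using slice_holomorphic_on[OF gn inV] by (rule holomorphic_on_imp_continuous_on)
    show "((\<lambda>t. g n (x + axis k t)) has_field_derivative pd k (g n) (x + axis k w)) (at w)"
      if "w \<in> ball 0 r" for w
      using that inV by (intro has_field_derivative_slice[OF gn]) auto
  qed
  have "r > 0" using e by (simp add: r_def)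
  then obtain G' where G': "\<And>w. w \<in> ball 0 r \<Longrightarrow>
      ((\<lambda>t. G (x + axis k t)) has_field_derivative G' w) (at w) \<and>
      ((\<lambda>n. pd k (g n) (x + axis k w)) \<longlongrightarrow> G' w) F"
    using has_complex_derivative_uniform_limit[OF cont ul F] by auto
  from G'[of 0] \<open>r > 0\<close> have *:
    "((\<lambda>t. G (x + axis k t)) has_field_derivative G' 0) (at 0)" "((\<lambda>n. pd k (g n) x) \<longlongrightarrow> G' 0) F"
    by auto
  from *(1) show "(\<lambda>t. G (x + axis k t)) field_differentiable at 0"
    unfolding field_differentiable_def by (rule exI)
  show "((\<lambda>n. pd k (g n) x) \<longlongrightarrow> pd k G x) F"
    using *(2) pd_eqI[OF *(1)] by simp
qed

lemma sep_holomorphic_uniform_limit: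
  fixes g :: "'i \<Rightarrow> complex^'n::finite \<Rightarrow> complex"
  assumes "uniform_limit V g G F" "F \<noteq> bot" "open V" "\<forall>\<^sub>F n in F. g n sep_holomorphic_on V"
  shows "G sep_holomorphic_on V"
  unfolding sep_holomorphic_on_def
proof (intro conjI ballI allI)
  show "continuous_on V G"
    using assms by (intro uniform_limit_theorem[OF _ assms(1,2)])
      (auto simp: sep_holomorphic_on_def elim: eventually_mono)
qed (rule slice_uniform_limit(1)[OF assms(1-3) _ assms(4)])

lemma pd_divide_diff_translate:
  assumes f: "f sep_holomorphic_on U" and x: "x \<in> U" "x + a \<in> U"
    and V: "\<And>y. y \<in> V \<Longrightarrow> y \<in> U \<and> y + a \<in> U" "x \<in> V"
  shows "pd k (\<lambda>x. (f (x + a) - f x) / c) x = (pd k f (x + a) - pd k f x) / c"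
proof -
  have ta: "(\<lambda>x. f (x + a)) sep_holomorphic_on V" and f': "f sep_holomorphic_on V"
    using V(1) by (blast intro: sep_holomorphic_translate[OF f] sep_holomorphic_on_subset[OF f])+
  have "pd k (\<lambda>x. inverse c * (f (x + a) - f x)) x = inverse c * (pd k (\<lambda>x. f (x + a)) x - pd k f x)"
    using pd_cmult[OF sep_holomorphic_diff[OF ta f'] V(2)] pd_diff[OF ta f' V(2)] by simp
  then show ?thesis
    by (simp add: pd_translate field_simps)
qed

lemma sep_holomorphic_difference_quotient:
  assumes f: "f sep_holomorphic_on U" and V: "\<And>y. y \<in> V \<Longrightarrow> y \<in> U \<and> y + a \<in> U"
  shows "(\<lambda>x. (f (x + a) - f x) / c) sep_holomorphic_on V"
proof -
  have "(\<lambda>x. inverse c * (f (x + a) - f x)) sep_holomorphic_on V"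
    using V by (intro sep_holomorphic_cmult sep_holomorphic_diff
        sep_holomorphic_translate[OF f] sep_holomorphic_on_subset[OF f]) auto
  then show ?thesis by (simp add: field_simps)
qed

text \<open>Near each point \<open>pd k f\<close> is a uniform limit of difference quotients, which
  are separately holomorphic; this also supplies its continuity.\<close>

lemma sep_holomorphic_pd:
  assumes f: "f sep_holomorphic_on U" and U: "open U"
  shows "pd k f sep_holomorphic_on U"
proof (rule sep_holomorphic_onI)
  fix x0 assume x0: "x0 \<in> U"
  obtain \<rho> h where \<rho>: "\<rho> > 0" "ball x0 (2 * \<rho>) \<subseteq> U" and h: "\<And>n. h n \<noteq> 0" "\<And>n. norm (h n) < \<rho>" "h \<longlonglongrightarrow> 0"
    and lim: "uniform_limit (ball x0 \<rho>) (\<lambda>n x. (f (x + axis k (h n)) - f x) / h n) (pd k f) sequentially"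
    by (rule uniform_limit_difference_quotient[OF f U x0, of k]) (rule that)
  have "y \<in> U \<and> y + axis k (h n) \<in> U" if "y \<in> ball x0 \<rho>" for y n
    using add_axis_in_ball[OF that less_imp_le[OF h(2)]] that \<rho> by (auto simp: subset_eq)
  then have "pd k f sep_holomorphic_on ball x0 \<rho>"
    by (intro sep_holomorphic_uniform_limit[OF lim] always_eventually allI
        sep_holomorphic_difference_quotient[OF f]) auto
  then show "\<exists>V. open V \<and> x0 \<in> V \<and> pd k f sep_holomorphic_on V"
    using \<rho> by (intro exI[of _ "ball x0 \<rho>"]) auto
qed

text \<open>Both mixed derivatives are limits of the same sequence: the difference quotients of \<open>pd k f\<close>
  are the \<open>k\<close>-th derivatives of the uniformly convergent difference quotients of \<open>f\<close>.\<close>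

lemma pd_commute:
  assumes f: "f sep_holomorphic_on U" and U: "open U" and x: "x \<in> U"
  shows "pd j (pd k f) x = pd k (pd j f) x"
proof -
  obtain \<rho> h where \<rho>: "\<rho> > 0" "ball x (2 * \<rho>) \<subseteq> U" and h: "\<And>n. h n \<noteq> 0" "\<And>n. norm (h n) < \<rho>" "h \<longlonglongrightarrow> 0"
    and lim: "uniform_limit (ball x \<rho>) (\<lambda>n x. (f (x + axis j (h n)) - f x) / h n) (pd j f) sequentially"
    by (rule uniform_limit_difference_quotient[OF f U x, of j]) (rule that)
  have V: "y \<in> U \<and> y + axis j (h n) \<in> U" if "y \<in> ball x \<rho>" for y n
    using add_axis_in_ball[OF that less_imp_le[OF h(2)]] that \<rho> by (auto simp: subset_eq)
  have "(\<lambda>n. pd k (\<lambda>x. (f (x + axis j (h n)) - f x) / h n) x) \<longlonglongrightarrow> pd k (pd j f) x"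
    using \<rho> V by (intro slice_uniform_limit(2)[OF lim] always_eventually allI
        sep_holomorphic_difference_quotient[OF f]) auto
  moreover have "pd k (\<lambda>x. (f (x + axis j (h n)) - f x) / h n) x
      = (pd k f (x + axis j (h n)) - pd k f x) / h n" for n
    using \<rho> x V by (intro pd_divide_diff_translate[OF f, where V = "ball x \<rho>"]) auto
  moreover have "(\<lambda>n. (pd k f (x + axis j (h n)) - pd k f x) / h n) \<longlonglongrightarrow> pd j (pd k f) x"
  proof -
    have "((\<lambda>s. (pd k f (x + axis j s) - pd k f x) / s) \<longlongrightarrow> pd j (pd k f) x) (at 0)"
      using has_field_derivative_slice_0[OF sep_holomorphic_pd[OF f U] x, of k j]
      by (simp add: DERIV_def)
    moreover have "filterlim h (at 0) sequentially"
      using h by (simp add: filterlim_at)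
    ultimately show ?thesis
      by (rule filterlim_compose)
  qed
  ultimately show ?thesis
    using LIMSEQ_unique by auto
qed


section \<open>Operators of the Weyl algebra\<close>

text \<open>The induction needs agreement near \<open>x\<close>, not just at \<open>x\<close>,
  because \<open>pd\<close> depends on the germ.\<close>

lemma weyl_local:
  assumes "P \<in> weyl" "\<forall>\<^sub>F y in nhds x. f y = g y"
  shows "\<forall>\<^sub>F y in nhds x. P f y = P g y"
  using assms
proof (induction arbitrary: f g rule: weyl.induct)
  case (pd j)
  show ?case
    using eventually_nhds_nhds[OF pd] by (rule eventually_mono) (rule pd_cong_ev)
next
  case (add P Q)
  show ?case
    using add.IH(1)[OF add.prems] add.IH(2)[OF add.prems] by eventually_elim simp
qed (auto elim: eventually_mono)

lemma weyl_cong: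
  assumes "P \<in> weyl" "open U" "\<And>y. y \<in> U \<Longrightarrow> f y = g y" "x \<in> U"
  shows "P f x = P g x"
proof -
  have "\<forall>\<^sub>F y in nhds x. f y = g y"
    using assms unfolding eventually_nhds by blast
  then show ?thesis
    using weyl_local[OF assms(1)] eventually_nhds_x_imp_x by blast
qed

lemma weyl_sep_holomorphic:
  assumes "P \<in> weyl" "f sep_holomorphic_on U" "open U"
  shows "P f sep_holomorphic_on U"
  using assms
  by (induction arbitrary: f rule: weyl.induct)
     (auto intro: sep_holomorphic_cmult sep_holomorphic_mult sep_holomorphic_coordinate
       sep_holomorphic_pd sep_holomorphic_add)

lemma weyl_lincomb:
  assumes "P \<in> weyl" "f sep_holomorphic_on U" "g sep_holomorphic_on U" "open U" "x \<in> U"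
  shows "P (\<lambda>x. a * f x + b * g x) x = a * P f x + b * P g x"
  using assms
proof (induction arbitrary: f g x rule: weyl.induct)
  case (pd j)
  then show ?case
    by (simp add: pd_add[OF sep_holomorphic_cmult sep_holomorphic_cmult] pd_cmult)
next
  case (mult P Q)
  have "(P \<circ> Q) (\<lambda>x. a * f x + b * g x) x = P (\<lambda>x. a * Q f x + b * Q g x) x"
    unfolding o_def
    by (rule weyl_cong[OF mult.hyps(1) \<open>open U\<close> mult.IH(2)[OF mult.prems(1-3)] \<open>x \<in> U\<close>])
  also have "\<dots> = a * P (Q f) x + b * P (Q g) x"
    by (intro mult.IH(1) weyl_sep_holomorphic[OF mult.hyps(2)] mult.prems)
  finally show ?case by simp
qed (auto simp: algebra_simps)

lemma weyl_id: "id \<in> weyl"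
  using weyl.const[of 1] by (simp add: id_def)

lemma weyl_sum:
  assumes "\<And>i. i \<in> I \<Longrightarrow> P i \<in> weyl"
  shows "(\<lambda>f x. \<Sum>i\<in>I. P i f x) \<in> weyl"
  using assms
proof (induction I rule: infinite_finite_induct)
  case (insert i I)
  then show ?case
    using weyl.add[of "P i" "\<lambda>f x. \<Sum>i\<in>I. P i f x"] by simp
qed (use weyl.const[of 0] in simp_all)

lemma weyl_cmult:
  assumes "P \<in> weyl"
  shows "(\<lambda>f x. c * P f x) \<in> weyl"
  using weyl.mult[OF weyl.const[of c] assms] by (simp add: o_def)

lemma weyl_coordinate_mult:
  assumes "P \<in> weyl"
  shows "(\<lambda>f x. x $ j * P f x) \<in> weyl"
  using weyl.mult[OF weyl.var[of j] assms] by (simp add: o_def)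

lemma weyl_funpow: "P \<in> weyl \<Longrightarrow> P ^^ n \<in> weyl"
  by (induction n) (simp_all only: funpow.simps weyl_id weyl.mult)

section \<open>Iterated partial derivatives\<close>

text \<open>\<open>pd_monom\<close> fixes the order of the variables by \<open>SOME\<close>. With
  the list as a parameter, statements can be proved by induction over it.\<close>

definition pd_list :: "'n::finite list \<Rightarrow> nat^'n \<Rightarrow> (complex^'n \<Rightarrow> complex) \<Rightarrow> complex^'n \<Rightarrow> complex" where
  "pd_list xs u = foldr (\<lambda>j P. (pd j ^^ (u $ j)) \<circ> P) xs id"

lemma pd_list_Nil [simp]: "pd_list [] u = id"
  and pd_list_Cons [simp]: "pd_list (a # xs) u = (pd a ^^ (u $ a)) \<circ> pd_list xs u"
  by (simp_all add: pd_list_def)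

lemma pd_monom_eq_pd_list:
  obtains xs where "distinct xs" "set xs = (UNIV :: 'n::finite set)"
    "\<And>u :: nat^'n. pd_monom u = pd_list xs u"
proof -
  obtain xs where "distinct xs" "set xs = (UNIV :: 'n::finite set)"
    using finite_distinct_list[of "UNIV :: 'n set"] by auto
  then have "\<exists>xs. distinct xs \<and> set xs = (UNIV :: 'n::finite set)" by blast
  from someI_ex[OF this] show thesis
    using that unfolding pd_monom_def pd_list_def by blast
qed

lemma weyl_pd_list: "pd_list xs u \<in> weyl"
  by (induction xs) (simp_all only: pd_list_Nil pd_list_Cons weyl_id weyl.mult weyl_funpow weyl.pd)

lemma weyl_pd_monom: "pd_monom u \<in> weyl"
  by (metis pd_monom_eq_pd_list weyl_pd_list)

lemma pd_funpow_commute: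
  assumes "f sep_holomorphic_on U" "open U" "x \<in> U"
  shows "pd j ((pd k ^^ n) f) x = (pd k ^^ n) (pd j f) x"
  using assms
proof (induction n arbitrary: x)
  case (Suc n)
  have "pd j ((pd k ^^ Suc n) f) x = pd k (pd j ((pd k ^^ n) f)) x"
    using pd_commute[OF weyl_sep_holomorphic[OF weyl_funpow[OF weyl.pd] Suc.prems(1,2)] Suc.prems(2,3)]
    by simp
  also have "\<dots> = pd k ((pd k ^^ n) (pd j f)) x"
    using Suc by (intro weyl_cong[OF weyl.pd, of U]) auto
  finally show ?case by simp
qed simp

lemma pd_list_commute:
  assumes "f sep_holomorphic_on U" "open U" "x \<in> U"
  shows "pd j (pd_list xs u f) x = pd_list xs u (pd j f) x"
  using assms
proof (induction xs arbitrary: x)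
  case (Cons a xs)
  have "pd j (pd_list (a # xs) u f) x = (pd a ^^ (u $ a)) (pd j (pd_list xs u f)) x"
    using pd_funpow_commute[OF weyl_sep_holomorphic[OF weyl_pd_list Cons.prems(1,2)] Cons.prems(2,3)]
    by simp
  also have "\<dots> = (pd a ^^ (u $ a)) (pd_list xs u (pd j f)) x"
    using Cons by (intro weyl_cong[OF weyl_funpow[OF weyl.pd], of U]) auto
  finally show ?case by simp
qed simp

text \<open>As the list is distinct, \<open>j\<close> occurs at most once. At its occurrence the
  extra derivative appears, and it then commutes past the remaining factors.\<close>

lemma pd_list_add_axis:
  assumes "f sep_holomorphic_on U" "open U" "x \<in> U" "distinct xs"
  shows "pd_list xs (u + axis j 1) f x = (if j \<in> set xs then pd j (pd_list xs u f) x else pd_list xs u f x)"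
  using assms
proof (induction xs arbitrary: x)
  case (Cons a xs)
  show ?case
  proof (cases "a = j")
    case True
    then have "pd_list xs (u + axis j 1) f y = pd_list xs u f y" if "y \<in> U" for y
      using Cons that by simp
    then have "(pd j ^^ Suc (u $ j)) (pd_list xs (u + axis j 1) f) x
        = (pd j ^^ Suc (u $ j)) (pd_list xs u f) x"
      using Cons.prems by (intro weyl_cong[OF weyl_funpow[OF weyl.pd], of U]) auto
    with True show ?thesis by (simp add: axis_def)
  next
    case False
    define g where "g = (if j \<in> set xs then pd j (pd_list xs u f) else pd_list xs u f)"
    have "pd_list (a # xs) (u + axis j 1) f x = (pd a ^^ (u $ a)) (pd_list xs (u + axis j 1) f) x"
      using False by (simp add: axis_def)
    also have "\<dots> = (pd a ^^ (u $ a)) g x"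
      using Cons by (intro weyl_cong[OF weyl_funpow[OF weyl.pd], of U]) (auto simp: g_def)
    also have "\<dots> = (if j \<in> set xs then pd j ((pd a ^^ (u $ a)) (pd_list xs u f)) x
        else (pd a ^^ (u $ a)) (pd_list xs u f) x)"
      using pd_funpow_commute[OF weyl_sep_holomorphic[OF weyl_pd_list Cons.prems(1,2)] Cons.prems(2,3)]
      by (simp add: g_def)
    finally show ?thesis using False by simp
  qed
qed simp

lemma pd_monom_add_axis:
  assumes "f sep_holomorphic_on U" "open U" "x \<in> U"
  shows "pd_monom (u + axis j 1) f x = pd j (pd_monom u f) x"
  using pd_monom_eq_pd_list pd_list_add_axis[OF assms] by (metis UNIV_I)

lemma pd_monom_commute:
  assumes "f sep_holomorphic_on U" "open U" "x \<in> U"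
  shows "pd j (pd_monom u f) x = pd_monom u (pd j f) x"
  using pd_monom_eq_pd_list pd_list_commute[OF assms] by metis

lemma pd_monom_0: "pd_monom 0 f = f"
proof -
  have "pd_list xs 0 f = f" for xs :: "'a list"
    by (induction xs) auto
  then show ?thesis
    using pd_monom_eq_pd_list by metis
qed

lemma nat_vec_induct [case_names zero add_axis]:
  fixes u :: "nat^'n::finite"
  assumes "P 0" "\<And>u j. P u \<Longrightarrow> P (u + axis j 1)"
  shows "P u"
proof (induction "\<Sum>j\<in>UNIV. u $ j" arbitrary: u)
  case 0
  then have "u = 0" by (simp add: vec_eq_iff)
  with assms(1) show ?case by simp
next
  case (Suc n)
  then obtain j where j: "u $ j > 0"
    by (metis gr0I sum.neutral zero_less_Suc less_irrefl)
  define w where "w = u - axis j 1"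
  have u: "u = w + axis j 1"
    using j by (auto simp: w_def vec_eq_iff axis_def)
  have "(\<Sum>i\<in>UNIV. u $ i) = (\<Sum>i\<in>UNIV. w $ i) + 1"
    by (simp add: u sum.distrib axis_def)
  then have "P w" using Suc by simp
  then show ?case using assms(2) u by metis
qed


section \<open>Polydiscs and analytic continuation\<close>

text \<open>Mixing the coordinates of two points of a polydisc never leaves it, unlike for a
  Euclidean ball. Any two of its points are therefore joined by changing one coordinate at a time,
  which reduces identity and constancy statements to slices.\<close>

definition polydisc :: "complex^'n \<Rightarrow> real \<Rightarrow> (complex^'n) set" where
  "polydisc a \<rho> = {x. \<forall>k. dist (x $ k) (a $ k) < \<rho>}"

lemma open_polydisc: "open (polydisc (a :: complex^'n::finite) \<rho>)"
proof -
  have "polydisc a \<rho> = (\<Inter>k. {x. dist (x $ k) (a $ k) < \<rho>})"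
    by (auto simp: polydisc_def)
  then show ?thesis
    by (auto intro!: open_INT open_Collect_less continuous_intros)
qed

lemma polydisc_subset:
  assumes "open U" "a \<in> U"
  obtains \<rho> where "\<rho> > 0" "polydisc (a :: complex^'n::finite) \<rho> \<subseteq> U"
proof -
  obtain e where e: "e > 0" "ball a e \<subseteq> U" using assms open_contains_ball by metis
  have "polydisc a (e / CARD('n)) \<subseteq> ball a e"
  proof
    fix x assume x: "x \<in> polydisc a (e / CARD('n))"
    have "norm (x - a) \<le> (\<Sum>k\<in>UNIV. norm ((x - a) $ k))"
      unfolding norm_vec_def by (rule L2_set_le_sum) auto
    also have "\<dots> < (\<Sum>k\<in>(UNIV :: 'n set). e / CARD('n))"
      using x by (intro sum_strict_mono) (auto simp: polydisc_def dist_norm)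
    finally show "x \<in> ball a e" by (simp add: dist_norm norm_minus_commute)
  qed
  then show thesis using that[of "e / CARD('n)"] e by auto
qed

lemma slice_in_polydisc:
  assumes "w \<in> polydisc a \<rho>" "s \<in> ball (a $ k - w $ k) \<rho>"
  shows "w + axis k s \<in> polydisc a \<rho>"
  using assms by (auto simp: polydisc_def axis_def dist_norm norm_minus_commute algebra_simps)

lemma slice_in_polydiscD:
  assumes "w + axis k s \<in> polydisc a \<rho>"
  shows "s \<in> ball (a $ k - w $ k) \<rho>"
proof -
  have "dist ((w + axis k s) $ k) (a $ k) < \<rho>"
    using assms unfolding polydisc_def by blast
  then show ?thesis
    by (simp add: axis_def dist_norm norm_minus_commute algebra_simps)
qed

lemma polydisc_induct:
  fixes x z :: "complex^'n::finite"
  assumes x: "x \<in> polydisc a \<rho>" "R x" and z: "z \<in> polydisc a \<rho>"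
    and step: "\<And>y k t. y \<in> polydisc a \<rho> \<Longrightarrow> R y \<Longrightarrow> y + axis k t \<in> polydisc a \<rho> \<Longrightarrow> R (y + axis k t)"
  shows "R z"
proof -
  define m where "m S = (\<chi> k. if k \<in> S then z $ k else x $ k)" for S
  have m: "m S \<in> polydisc a \<rho>" for S
    using x z by (auto simp: polydisc_def m_def)
  have "R (m S)" if "finite S" for S
    using that
  proof induction
    case empty
    then show ?case using x by (simp add: m_def)
  next
    case (insert k S)
    have "m (insert k S) = m S + axis k (z $ k - x $ k)"
      using insert.hyps by (auto simp: m_def vec_eq_iff axis_def)
    then show ?case using step[OF m insert.IH, of k "z $ k - x $ k"] m[of "insert k S"] by simp
  qed
  from this[of UNIV] show ?thesis by (simp add: m_def)
qed

text \<open>The property carried along is vanishing near a point. If \<open>w\<close> is near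
  \<open>y + axis k t\<close>, then \<open>b = w - axis k t\<close> is near \<open>y\<close>, so
  \<open>f\<close> vanishes on the slice through \<open>b\<close> for small parameters, and the
  one-variable identity theorem on the disc of that slice gives \<open>f w = 0\<close>.\<close>

lemma polydisc_identity:
  assumes f: "f sep_holomorphic_on polydisc a \<rho>" and x: "x \<in> polydisc a \<rho>"
    and 0: "\<forall>\<^sub>F y in nhds x. f y = 0" and z: "z \<in> polydisc a \<rho>"
  shows "\<forall>\<^sub>F y in nhds z. f y = 0"
proof (rule polydisc_induct[where R = "\<lambda>x. \<forall>\<^sub>F y in nhds x. f y = 0", OF x 0 z])
  fix y k t
  assume y: "y \<in> polydisc a \<rho>" "\<forall>\<^sub>F y in nhds y. f y = 0" and yt: "y + axis k t \<in> polydisc a \<rho>"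
  have "\<forall>\<^sub>F w in nhds y. w \<in> polydisc a \<rho>"
    using open_polydisc y(1) by (rule eventually_nhds_in_open)
  with y(2) have "\<forall>\<^sub>F w in nhds y. (\<forall>\<^sub>F v in nhds w. f v = 0) \<and> w \<in> polydisc a \<rho>"
    by (intro eventually_conj eventually_nhds_nhds)
  moreover have "((\<lambda>w. w - axis k t) \<longlongrightarrow> y) (nhds (y + axis k t))"
  proof -
    have "((\<lambda>w. w - axis k t) \<longlongrightarrow> (y + axis k t) - axis k t) (nhds (y + axis k t))"
      by (intro tendsto_intros) (simp add: filterlim_ident)
    then show ?thesis by simp
  qed
  ultimately have "\<forall>\<^sub>F w in nhds (y + axis k t).
      (\<forall>\<^sub>F v in nhds (w - axis k t). f v = 0) \<and> w - axis k t \<in> polydisc a \<rho>"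
    unfolding filterlim_iff by blast
  moreover have "\<forall>\<^sub>F w in nhds (y + axis k t). w \<in> polydisc a \<rho>"
    using open_polydisc yt by (rule eventually_nhds_in_open)
  ultimately show "\<forall>\<^sub>F w in nhds (y + axis k t). f w = 0"
  proof eventually_elim
    case (elim w)
    define b where "b = w - axis k t"
    have b: "b \<in> polydisc a \<rho>" "\<forall>\<^sub>F v in nhds b. f v = 0" "b + axis k t \<in> polydisc a \<rho>"
      using elim by (auto simp: b_def)
    define S where "S = ball (a $ k - b $ k) \<rho>"
    have hol: "(\<lambda>s. f (b + axis k s)) holomorphic_on S"
      using slice_in_polydisc[OF b(1)] by (intro slice_holomorphic_on[OF f]) (simp add: S_def)
    have "\<forall>\<^sub>F s in nhds 0. f (b + axis k s) = 0"
      using eventually_slice[OF b(2)] .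
    moreover have "\<forall>\<^sub>F s in nhds 0. s \<in> S"
      using b(1) slice_in_polydiscD[of b k 0 a \<rho>] by (intro eventually_nhds_in_open) (auto simp: S_def)
    ultimately have "\<forall>\<^sub>F s in nhds 0. f (b + axis k s) = 0 \<and> s \<in> S"
      by (rule eventually_conj)
    then obtain T where T: "open T" "0 \<in> T" "\<And>s. s \<in> T \<Longrightarrow> f (b + axis k s) = 0 \<and> s \<in> S"
      unfolding eventually_nhds by blast
    have "f (b + axis k t) = 0"
    proof (rule analytic_continuation_open[where f = "\<lambda>s. f (b + axis k s)" and g = "\<lambda>_. 0"
          and s = T and s' = S])
      show "t \<in> S" using slice_in_polydiscD[OF b(3)] by (simp add: S_def)
    qed (use T hol in \<open>auto simp: S_def\<close>)
    then show ?case by (simp add: b_def)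
  qed
qed

text \<open>Vanishing of \<open>P (F t)\<close> near \<open>\<gamma> t\<close> is a locally constant
  property of \<open>t\<close>: for \<open>s\<close> close to \<open>t\<close> the germs of
  \<open>F s\<close> and \<open>F t\<close> at \<open>\<gamma> s\<close> agree, and the identity
  theorem on a polydisc around \<open>\<gamma> t\<close> compares the germs of
  \<open>P (F t)\<close> at \<open>\<gamma> s\<close> and \<open>\<gamma> t\<close>. The unit
  interval is connected.\<close>

lemma weyl_continuation:
  assumes P: "P \<in> weyl" and c: "continues_to g q f p"
  shows "(\<forall>\<^sub>F x in nhds q. P g x = 0) \<longleftrightarrow> (\<forall>\<^sub>F x in nhds p. P f x = 0)"
proof -
  obtain \<gamma> F \<rho> where \<gamma>: "path \<gamma>" "pathstart \<gamma> = q" "pathfinish \<gamma> = p"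
    and F: "\<forall>t\<in>{0..1}. \<rho> t > 0 \<and> F t mholomorphic_on ball (\<gamma> t) (\<rho> t)"
    and loc: "\<forall>t\<in>{0..1}. \<exists>\<delta>>0. \<forall>s\<in>{0..1}. \<bar>s - t\<bar> < \<delta> \<longrightarrow>
           (\<forall>\<^sub>F x in nhds (\<gamma> s). F s x = F t x)"
    and start: "\<forall>\<^sub>F x in nhds q. F (0::real) x = g x"
    and finish: "\<forall>\<^sub>F x in nhds p. F 1 x = f x"
    using c unfolding continues_to_def by (elim exE conjE) (rule that)
  define Z where "Z t \<longleftrightarrow> (\<forall>\<^sub>F x in nhds (\<gamma> t). P (F t) x = 0)" for t
  have "Z 0 = Z 1"
  proof (rule connected_local_const[of "{0..1::real}"])
    show "\<forall>t\<in>{0..1}. \<forall>\<^sub>F s in at t within {0..1}. Z t = Z s"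
    proof
      fix t :: real assume t: "t \<in> {0..1}"
      obtain \<delta> where \<delta>: "\<delta> > 0" "\<And>s. s \<in> {0..1} \<Longrightarrow> \<bar>s - t\<bar> < \<delta> \<Longrightarrow>
           (\<forall>\<^sub>F x in nhds (\<gamma> s). F s x = F t x)"
        using bspec[OF loc t] by blast
      obtain e where e: "e > 0" "polydisc (\<gamma> t) e \<subseteq> ball (\<gamma> t) (\<rho> t)"
        using polydisc_subset[of "ball (\<gamma> t) (\<rho> t)" "\<gamma> t"] bspec[OF F t] by auto
      have hol: "P (F t) sep_holomorphic_on polydisc (\<gamma> t) e"
        using bspec[OF F t] e(2) sep_holomorphic_on_subset mholomorphic_imp_sep_holomorphic
        by (intro weyl_sep_holomorphic[OF P _ open_polydisc]) blast
      have centre: "\<gamma> t \<in> polydisc (\<gamma> t) e" using e by (simp add: polydisc_def)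
      have "(\<gamma> \<longlongrightarrow> \<gamma> t) (at t within {0..1})"
        using \<gamma>(1) t unfolding path_def continuous_on_def by blast
      then have "\<forall>\<^sub>F s in at t within {0..1}. \<gamma> s \<in> polydisc (\<gamma> t) e"
        using centre open_polydisc topological_tendstoD by blast
      moreover have "\<forall>\<^sub>F s in at t within {0..1}. s \<in> {0..1} \<and> \<bar>s - t\<bar> < \<delta>"
        unfolding eventually_at using \<delta>(1) by (auto simp: dist_real_def)
      ultimately show "\<forall>\<^sub>F s in at t within {0..1}. Z t = Z s"
      proof eventually_elim
        case (elim s)
        then have s: "\<forall>\<^sub>F x in nhds (\<gamma> s). P (F s) x = P (F t) x"
          by (intro weyl_local[OF P] \<delta>(2)) auto
        have "Z s \<longleftrightarrow> (\<forall>\<^sub>F x in nhds (\<gamma> s). P (F t) x = 0)"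
          unfolding Z_def by (rule eventually_subst) (use s in \<open>auto elim: eventually_mono\<close>)
        also have "\<dots> \<longleftrightarrow> Z t"
          unfolding Z_def using polydisc_identity[OF hol] elim(1) centre by blast
        finally show ?case by simp
      qed
    qed
  qed auto
  moreover have "(\<forall>\<^sub>F x in nhds q. P g x = 0) = Z 0"
    unfolding Z_def using \<gamma>(2) weyl_local[OF P start]
    by (simp add: pathstart_def) (rule eventually_subst, auto elim: eventually_mono)
  moreover have "(\<forall>\<^sub>F x in nhds p. P f x = 0) = Z 1"
    unfolding Z_def using \<gamma>(3) weyl_local[OF P finish]
    by (simp add: pathfinish_def) (rule eventually_subst, auto elim: eventually_mono)
  ultimately show ?thesis by simp
qed

lemma polydisc_constant:
  assumes f: "f sep_holomorphic_on polydisc a \<rho>" and x: "x \<in> polydisc a \<rho>" and z: "z \<in> polydisc a \<rho>"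
    and pd0: "\<And>y k. y \<in> polydisc a \<rho> \<Longrightarrow> pd k f y = 0"
  shows "f z = f x"
proof (rule polydisc_induct[where R = "\<lambda>y. f y = f x", OF x refl z])
  fix y k t
  assume y: "y \<in> polydisc a \<rho>" "f y = f x" and yt: "y + axis k t \<in> polydisc a \<rho>"
  define S where "S = ball (a $ k - y $ k) \<rho>"
  have "\<exists>c. \<forall>s\<in>S. f (y + axis k s) = c"
  proof (rule has_field_derivative_zero_constant)
    fix s assume "s \<in> S"
    then have "y + axis k s \<in> polydisc a \<rho>"
      using slice_in_polydisc[OF y(1)] by (simp add: S_def)
    then show "((\<lambda>s. f (y + axis k s)) has_field_derivative 0) (at s within S)"
      using has_field_derivative_slice[OF f] pd0 by (metis has_field_derivative_at_within)
  qed (simp add: S_def)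
  moreover have "0 \<in> S" "t \<in> S"
    using slice_in_polydiscD[of y k 0 a \<rho>] slice_in_polydiscD[OF yt] y(1) by (auto simp: S_def)
  ultimately have "f (y + axis k t) = f (y + axis k 0)" by metis
  with y show "f (y + axis k t) = f x" by simp
qed


section \<open>Branches of monomials\<close>

definition log_branch :: "(complex^'n::finite \<Rightarrow> complex^'n) \<Rightarrow> (complex^'n) set \<Rightarrow> bool" where
  "log_branch L U \<longleftrightarrow>
     (\<forall>j. (\<lambda>x. L x $ j) sep_holomorphic_on U) \<and> (\<forall>x\<in>U. \<forall>j. exp (L x $ j) = x $ j)"

definition monomial :: "(complex^'n::finite \<Rightarrow> complex^'n) \<Rightarrow> complex^'n \<Rightarrow> complex^'n \<Rightarrow> complex" where
  "monomial L y x = exp (\<Sum>j\<in>UNIV. y $ j * L x $ j)"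

lemma log_branch_subset: "log_branch L U \<Longrightarrow> V \<subseteq> U \<Longrightarrow> log_branch L V"
  unfolding log_branch_def using sep_holomorphic_on_subset by blast

lemma log_branch_nonzero: "log_branch L U \<Longrightarrow> x \<in> U \<Longrightarrow> x $ j \<noteq> 0"
  unfolding log_branch_def by (metis exp_not_eq_zero)

lemma monomial_nonzero: "monomial L y x \<noteq> 0"
  by (simp add: monomial_def)

lemma sep_holomorphic_monomial: "log_branch L U \<Longrightarrow> monomial L y sep_holomorphic_on U"
  unfolding log_branch_def monomial_def[abs_def]
  by (intro sep_holomorphic_exp sep_holomorphic_sum sep_holomorphic_cmult) auto

lemma monomial_add_axis:
  assumes "log_branch L U" "x \<in> U"
  shows "x $ k * monomial L y x = monomial L (y + axis k 1) x"
proof -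
  have "(\<Sum>j\<in>UNIV. (y + axis k 1) $ j * L x $ j) = (\<Sum>j\<in>UNIV. y $ j * L x $ j) + L x $ k"
    by (simp add: distrib_right sum.distrib axis_def if_distrib[of "\<lambda>c. c * _"] cong: if_cong)
  moreover have "exp (L x $ k) = x $ k"
    using assms unfolding log_branch_def by blast
  ultimately show ?thesis
    by (simp add: monomial_def exp_add)
qed

lemma pd_log_branch:
  assumes L: "log_branch L U" and U: "open U" and x: "x \<in> U"
  shows "x $ j * pd k (\<lambda>x. L x $ j) x = (if j = k then 1 else 0)"
proof -
  have Lj: "(\<lambda>x. L x $ j) sep_holomorphic_on U" and eL: "\<And>x. x \<in> U \<Longrightarrow> exp (L x $ j) = x $ j"
    using L unfolding log_branch_def by auto
  have "pd k (\<lambda>x. exp (L x $ j)) x = pd k (\<lambda>x. x $ j) x"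
    by (rule weyl_cong[OF weyl.pd U eL x])
  then show ?thesis
    using pd_exp[OF Lj x] eL[OF x] by (simp add: pd_coordinate)
qed

lemma pd_monomial:
  assumes L: "log_branch L U" and U: "open U" and x: "x \<in> U"
  shows "x $ k * pd k (monomial L y) x = y $ k * monomial L y x"
proof -
  have Lj: "(\<lambda>x. y $ j * L x $ j) sep_holomorphic_on U" "(\<lambda>x. L x $ j) sep_holomorphic_on U" for j
    using L unfolding log_branch_def by (auto intro: sep_holomorphic_cmult)
  have "pd k (monomial L y) x = monomial L y x * (\<Sum>j\<in>UNIV. y $ j * pd k (\<lambda>x. L x $ j) x)"
    unfolding monomial_def[abs_def]
    using pd_exp[OF sep_holomorphic_sum[of UNIV "\<lambda>j x. y $ j * L x $ j", OF Lj(1)] x, of k]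
      pd_sum[of UNIV "\<lambda>j x. y $ j * L x $ j", OF Lj(1) x, of k] pd_cmult[OF Lj(2) x, of k] by simp
  moreover have "pd k (\<lambda>x. L x $ j) x = (if j = k then 1 / x $ k else 0)" for j
    using pd_log_branch[OF L U x, of j k] log_branch_nonzero[OF L x, of j]
    by (auto simp: field_simps split: if_splits)
  ultimately show ?thesis
    using log_branch_nonzero[OF L x, of k] by (simp add: if_distrib cong: if_cong)
qed

lemma pd_monomial_eq:
  assumes L: "log_branch L U" and U: "open U" and x: "x \<in> U"
  shows "pd k (monomial L y) x = y $ k * monomial L (y - axis k 1) x"
proof -
  have "x $ k * pd k (monomial L y) x = x $ k * (y $ k * monomial L (y - axis k 1) x)"
    using pd_monomial[OF assms, of k y] monomial_add_axis[OF L x, of k "y - axis k 1"]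
    by (simp add: mult.left_commute)
  then show ?thesis using log_branch_nonzero[OF L x, of k] by simp
qed

text \<open>The product of \<open>h\<close> with the monomial of exponent \<open>- y\<close> has
  vanishing partial derivatives, so it is constant near \<open>p\<close>, with value 0. A single
  value thus decides the germ, which is what permits functionals that merely evaluate at
  \<open>p\<close>.\<close>

lemma euler_eigenfunction_zero:
  assumes L: "log_branch L U" and U: "open U" and p: "p \<in> U" and h: "h sep_holomorphic_on U"
    and eig: "\<And>x k. x \<in> U \<Longrightarrow> x $ k * pd k h x = y $ k * h x" and 0: "h p = 0"
  shows "\<forall>\<^sub>F x in nhds p. h x = 0"
proof -
  define G where "G x = h x * monomial L (- y) x" for x
  have mono: "monomial L (- y) sep_holomorphic_on U" by (rule sep_holomorphic_monomial[OF L])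
  obtain \<rho> where \<rho>: "\<rho> > 0" "polydisc p \<rho> \<subseteq> U" using polydisc_subset[OF U p] .
  have G: "G sep_holomorphic_on U"
    unfolding G_def[abs_def] by (intro sep_holomorphic_mult h mono)
  have pdG: "pd k G x = 0" if x: "x \<in> U" for x k
  proof -
    have "x $ k * pd k G x = x $ k * pd k h x * monomial L (- y) x + h x * (x $ k * pd k (monomial L (- y)) x)"
      unfolding G_def[abs_def] using pd_mult[OF h mono x] by (simp add: algebra_simps)
    also have "\<dots> = 0"
      using eig[OF x] pd_monomial[OF L U x, of k "- y"] by (simp add: algebra_simps)
    finally show ?thesis using log_branch_nonzero[OF L x] by simp
  qed
  have "h x = 0" if x: "x \<in> polydisc p \<rho>" for x
  proof -
    have "G x = G p"
    proof (rule polydisc_constant[OF sep_holomorphic_on_subset[OF G \<rho>(2)] _ x])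
      show "p \<in> polydisc p \<rho>" using \<rho>(1) by (simp add: polydisc_def)
    qed (use pdG \<rho>(2) in blast)
    then show ?thesis using 0 by (simp add: G_def monomial_nonzero)
  qed
  then show ?thesis
    unfolding eventually_nhds using open_polydisc[of p \<rho>] \<rho>(1)
    by (intro exI[of _ "polydisc p \<rho>"]) (auto simp: polydisc_def)
qed


section \<open>Normally convergent series\<close>

text \<open>Pointwise summation alone does not justify termwise differentiation. The majorant
  \<open>M\<close>, independent of \<open>x\<close>, gives uniform convergence, and it is part of
  the notion so that derivatives can be differentiated again.\<close>

definition normal_series ::
  "'i set \<Rightarrow> ('i \<Rightarrow> complex^'n::finite \<Rightarrow> complex) \<Rightarrow> (complex^'n \<Rightarrow> complex) \<Rightarrow> complex^'n \<Rightarrow> real \<Rightarrow> bool" where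
  "normal_series I T f q \<epsilon> \<longleftrightarrow> \<epsilon> > 0 \<and>
     (\<exists>M. M summable_on I \<and>
        (\<forall>i\<in>I. T i sep_holomorphic_on ball q \<epsilon> \<and> (\<forall>x\<in>ball q \<epsilon>. norm (T i x) \<le> M i))) \<and>
     (\<forall>x\<in>ball q \<epsilon>. ((\<lambda>i. T i x) has_sum f x) I)"

lemma normal_series_uniform_limit:
  assumes "normal_series I T f q \<epsilon>"
  shows "uniform_limit (ball q \<epsilon>) (\<lambda>F x. \<Sum>i\<in>F. T i x) f (finite_subsets_at_top I)"
    and "\<forall>\<^sub>F F in finite_subsets_at_top I. (\<lambda>x. \<Sum>i\<in>F. T i x) sep_holomorphic_on ball q \<epsilon>"
proof -
  obtain M where M: "M summable_on I" "\<And>i. i \<in> I \<Longrightarrow> T i sep_holomorphic_on ball q \<epsilon>"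
    "\<And>i x. i \<in> I \<Longrightarrow> x \<in> ball q \<epsilon> \<Longrightarrow> norm (T i x) \<le> M i"
    and S: "\<And>x. x \<in> ball q \<epsilon> \<Longrightarrow> ((\<lambda>i. T i x) has_sum f x) I"
    using assms unfolding normal_series_def by blast
  show "uniform_limit (ball q \<epsilon>) (\<lambda>F x. \<Sum>i\<in>F. T i x) f (finite_subsets_at_top I)"
    by (rule Weierstrass_m_test_general'[OF M(3) S M(1)])
  show "\<forall>\<^sub>F F in finite_subsets_at_top I. (\<lambda>x. \<Sum>i\<in>F. T i x) sep_holomorphic_on ball q \<epsilon>"
    by (intro eventually_finite_subsets_at_top_weakI sep_holomorphic_sum M(2)) auto
qed

lemma normal_series_sep_holomorphic:
  assumes "normal_series I T f q \<epsilon>"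
  shows "f sep_holomorphic_on ball q \<epsilon>"
  using normal_series_uniform_limit[OF assms]
  by (intro sep_holomorphic_uniform_limit[where F = "finite_subsets_at_top I"]) auto

lemma normal_series_cong:
  assumes s: "normal_series I T f q \<epsilon>"
    and T: "\<And>i x. i \<in> I \<Longrightarrow> x \<in> ball q \<epsilon> \<Longrightarrow> T i x = T' i x"
    and f: "\<And>x. x \<in> ball q \<epsilon> \<Longrightarrow> f x = f' x"
  shows "normal_series I T' f' q \<epsilon>"
proof -
  obtain M where M: "\<epsilon> > 0" "M summable_on I" "\<And>i. i \<in> I \<Longrightarrow> T i sep_holomorphic_on ball q \<epsilon>"
    "\<And>i x. i \<in> I \<Longrightarrow> x \<in> ball q \<epsilon> \<Longrightarrow> norm (T i x) \<le> M i"
    and S: "\<And>x. x \<in> ball q \<epsilon> \<Longrightarrow> ((\<lambda>i. T i x) has_sum f x) I"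
    using s unfolding normal_series_def by blast
  have "T' i sep_holomorphic_on ball q \<epsilon>" if "i \<in> I" for i
    using sep_holomorphic_on_cong[OF M(3)[OF that] open_ball T[OF that]] .
  moreover have "norm (T' i x) \<le> M i" if "i \<in> I" "x \<in> ball q \<epsilon>" for i x
    using M(4)[OF that] T[OF that] by simp
  moreover have "((\<lambda>i. T' i x) has_sum f' x) I" if "x \<in> ball q \<epsilon>" for x
    using S[OF that] f[OF that] has_sum_cong[of I "\<lambda>i. T i x" "\<lambda>i. T' i x"] T that by simp
  ultimately show ?thesis
    unfolding normal_series_def using M(1,2) by blast
qed

text \<open>Cauchy's inequality on slice discs of radius \<open>\<epsilon> / 4\<close>, which stay
  in the larger ball when centred in the half ball, turns \<open>M\<close> into a majorant of the
  derivatives.\<close>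

lemma normal_series_pd:
  assumes s: "normal_series I T f q \<epsilon>"
  shows "normal_series I (\<lambda>i. pd k (T i)) (pd k f) q (\<epsilon> / 2)"
proof -
  obtain M where \<epsilon>: "\<epsilon> > 0" and M: "M summable_on I" "\<And>i. i \<in> I \<Longrightarrow> T i sep_holomorphic_on ball q \<epsilon>"
    "\<And>i x. i \<in> I \<Longrightarrow> x \<in> ball q \<epsilon> \<Longrightarrow> norm (T i x) \<le> M i"
    using s unfolding normal_series_def by blast
  have sub: "ball q (\<epsilon> / 2) \<subseteq> ball q \<epsilon>" using \<epsilon> by (intro subset_ball) simp
  have hol: "pd k (T i) sep_holomorphic_on ball q (\<epsilon> / 2)" if "i \<in> I" for i
    using sep_holomorphic_on_subset[OF sep_holomorphic_pd[OF M(2)[OF that] open_ball] sub] .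
  have bound: "norm (pd k (T i) x) \<le> inverse (\<epsilon> / 4) * M i" if i: "i \<in> I" and x: "x \<in> ball q (\<epsilon> / 2)" for i x
  proof -
    have inb: "x + axis k t \<in> ball q \<epsilon>" if "norm t \<le> \<epsilon> / 4" for t
      using add_axis_in_ball[OF x that, of k] \<epsilon> by simp
    have "norm ((deriv ^^ 1) (\<lambda>t. T i (x + axis k t)) 0) \<le> fact 1 * M i / (\<epsilon> / 4) ^ 1"
    proof (rule Cauchy_inequality)
      show "(\<lambda>t. T i (x + axis k t)) holomorphic_on ball 0 (\<epsilon> / 4)"
        by (rule slice_holomorphic_on[OF M(2)[OF i] inb]) simp
      have "(\<lambda>t. T i (x + axis k t)) holomorphic_on cball 0 (\<epsilon> / 4)"
        by (rule slice_holomorphic_on[OF M(2)[OF i] inb]) simp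
      then show "continuous_on (cball 0 (\<epsilon> / 4)) (\<lambda>t. T i (x + axis k t))"
        by (rule holomorphic_on_imp_continuous_on)
      show "norm (T i (x + axis k t)) \<le> M i" if "norm (0 - t) = \<epsilon> / 4" for t
        using that by (intro M(3)[OF i inb]) simp
    qed (use \<epsilon> in simp)
    then show ?thesis by (simp add: pd_def field_simps)
  qed
  have "((\<lambda>i. pd k (T i) x) has_sum pd k f x) I" if "x \<in> ball q (\<epsilon> / 2)" for x
  proof -
    have x: "x \<in> ball q \<epsilon>" using that sub by blast
    have "((\<lambda>F. pd k (\<lambda>x. \<Sum>i\<in>F. T i x) x) \<longlongrightarrow> pd k f x) (finite_subsets_at_top I)"
      using normal_series_uniform_limit[OF s] x by (intro slice_uniform_limit(2)[where V = "ball q \<epsilon>"]) auto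
    moreover have "\<forall>\<^sub>F F in finite_subsets_at_top I.
        pd k (\<lambda>x. \<Sum>i\<in>F. T i x) x = (\<Sum>i\<in>F. pd k (T i) x)"
      by (intro eventually_finite_subsets_at_top_weakI pd_sum[OF M(2) x]) auto
    ultimately show ?thesis
      unfolding has_sum_def by (rule Lim_transform_eventually)
  qed
  moreover have "(\<lambda>i. inverse (\<epsilon> / 4) * M i) summable_on I"
    using M(1) by (rule summable_on_cmult_right)
  ultimately show ?thesis
    unfolding normal_series_def using \<epsilon> hol bound by (intro conjI exI[of _ "\<lambda>i. inverse (\<epsilon> / 4) * M i"]) auto
qed


section \<open>Coefficients of the logarithm-free series\<close>

text \<open>This is Gamma(a + 1) / Gamma(a + k + 1) wherever both Gamma values are finite, the
  contribution of one coordinate to \<open>phi_coeff\<close>.\<close>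

definition shift_coeff :: "complex \<Rightarrow> int \<Rightarrow> complex" where
  "shift_coeff a k = (\<Prod>j=1..nat (- k). a - of_nat j + 1) / (\<Prod>j=1..nat k. a + of_nat j)"

lemma phi_coeff_eq_prod: "phi_coeff u l = (\<Prod>i\<in>UNIV. shift_coeff (u $ i) (l $ i))"
proof -
  have "(\<Prod>i\<in>{i. l $ i < 0}. \<Prod>j=1..nat (- (l $ i)). u $ i - of_nat j + 1)
      = (\<Prod>i\<in>UNIV. \<Prod>j=1..nat (- (l $ i)). u $ i - of_nat j + 1)"
    by (rule prod.mono_neutral_left) auto
  moreover have "(\<Prod>i\<in>{i. l $ i > 0}. \<Prod>j=1..nat (l $ i). u $ i + of_nat j)
      = (\<Prod>i\<in>UNIV. \<Prod>j=1..nat (l $ i). u $ i + of_nat j)"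
    by (rule prod.mono_neutral_left) auto
  ultimately show ?thesis
    unfolding phi_coeff_def shift_coeff_def by (simp add: prod_dividef)
qed

lemma shift_coeff_minus_1:
  assumes "a + of_int k \<noteq> 0"
  shows "shift_coeff a (k - 1) = (a + of_int k) * shift_coeff a k"
proof (cases "k \<le> 0")
  case True
  define n where "n = nat (- k)"
  have k: "k = - int n" using True by (simp add: n_def)
  have "nat (- (k - 1)) = Suc n" "nat (- k) = n" "nat (k - 1) = 0" "nat k = 0" using k by auto
  then show ?thesis
    unfolding shift_coeff_def using k by simp
next
  case False
  define n where "n = nat (k - 1)"
  have k: "k = int n + 1" using False by (simp add: n_def)
  have "nat (- (k - 1)) = 0" "nat (- k) = 0" "nat (k - 1) = n" "nat k = Suc n" using k by auto
  then show ?thesis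
    unfolding shift_coeff_def using k assms by (simp add: add_ac)
qed

text \<open>A factor vanishes only if \<open>a\<close> and \<open>a + of_int k\<close> are integers
  on different sides of the gap between -1 and 0, in which case exactly one of them is a negative
  integer.\<close>

lemma shift_coeff_nonzero:
  assumes "(\<exists>m::int. m < 0 \<and> a = of_int m) \<longleftrightarrow> (\<exists>m::int. m < 0 \<and> a + of_int k = of_int m)"
  shows "shift_coeff a k \<noteq> 0"
proof -
  have "a - of_nat j + 1 \<noteq> 0" if "j \<in> {1..nat (- k)}" for j
  proof
    assume "a - of_nat j + 1 = 0"
    then have a: "a = of_int (int j - 1)" by (simp add: algebra_simps)
    then have "a + of_int k = of_int (int j - 1 + k)" by simp
    moreover have "int j - 1 + k < 0" using that by auto
    ultimately obtain m :: int where m: "m < 0" "a = of_int m"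
      using assms by blast
    with a have "m = int j - 1" by (simp only: of_int_eq_iff)
    with m that show False by auto
  qed
  moreover have "a + of_nat j \<noteq> 0" if "j \<in> {1..nat k}" for j
  proof
    assume "a + of_nat j = 0"
    then have a: "a = of_int (- int j)" by (simp add: eq_neg_iff_add_eq_0)
    moreover have "- int j < 0" using that by auto
    ultimately obtain m :: int where m: "m < 0" "a + of_int k = of_int m"
      using assms by blast
    then have "of_int (- int j + k) = (of_int m :: complex)" using a by simp
    then have "- int j + k = m" by (simp only: of_int_eq_iff)
    with m that show False by auto
  qed
  ultimately show ?thesis
    unfolding shift_coeff_def by auto
qed

text \<open>Derivatives move exponents off the kernel lattice, so coefficients are needed for every
  integral \<open>l\<close>. The value 0 off the negative support of \<open>u\<close> lets every sum
  run over the full lattice, which translations preserve.\<close>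

definition ext_coeff :: "complex^'n::finite \<Rightarrow> int^'n \<Rightarrow> complex" where
  "ext_coeff u l = (if nsupp (u + cvec l) = nsupp u then phi_coeff u l else 0)"

lemma nsupp_cvec: "i \<in> nsupp (u + cvec l) \<longleftrightarrow> (\<exists>m::int. m < 0 \<and> u $ i + of_int (l $ i) = of_int m)"
  by (simp add: nsupp_def cvec_def)

lemma ext_coeff_nonzero:
  assumes "nsupp (u + cvec l) = nsupp u"
  shows "ext_coeff u l \<noteq> 0"
proof -
  have "shift_coeff (u $ i) (l $ i) \<noteq> 0" for i
    using assms nsupp_cvec[of i u l] by (intro shift_coeff_nonzero) (auto simp: nsupp_def)
  then show ?thesis
    using assms by (simp add: ext_coeff_def phi_coeff_eq_prod)
qed

lemma nsupp_minus_axis_other: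
  "i \<noteq> k \<Longrightarrow> i \<in> nsupp (u + cvec (l - axis k 1)) \<longleftrightarrow> i \<in> nsupp (u + cvec l)"
  by (simp add: nsupp_cvec axis_def)

lemma nsupp_minus_axis:
  assumes "u $ k + of_int (l $ k) \<noteq> 0"
  shows "nsupp (u + cvec (l - axis k 1)) = nsupp (u + cvec l)"
proof -
  have "k \<in> nsupp (u + cvec (l - axis k 1)) \<longleftrightarrow> k \<in> nsupp (u + cvec l)"
  proof
    assume "k \<in> nsupp (u + cvec (l - axis k 1))"
    then obtain m :: int where m: "m < 0" "u $ k + of_int (l $ k) - 1 = of_int m"
      by (auto simp: nsupp_cvec axis_def algebra_simps)
    then have *: "u $ k + of_int (l $ k) = of_int (m + 1)" by (simp add: algebra_simps)
    with assms have "m + 1 \<noteq> 0" by (metis of_int_0)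
    with m have "m + 1 < 0" by simp
    then show "k \<in> nsupp (u + cvec l)" using * unfolding nsupp_cvec by blast
  next
    assume "k \<in> nsupp (u + cvec l)"
    then obtain m :: int where m: "m < 0" "u $ k + of_int (l $ k) = of_int m"
      by (auto simp: nsupp_cvec)
    then have "u $ k + of_int ((l - axis k 1) $ k) = of_int (m - 1)" "m - 1 < 0"
      by (auto simp: axis_def algebra_simps)
    then show "k \<in> nsupp (u + cvec (l - axis k 1))" unfolding nsupp_cvec by blast
  qed
  then show ?thesis
    using nsupp_minus_axis_other[of _ k u l] by (intro set_eqI) metis
qed

text \<open>The rule for differentiating x^(u+l). The premise excludes that exponent
  \<open>k\<close> falls from 0 to -1 while \<open>k\<close> is in \<open>nsupp u\<close>: then the
  coefficient at \<open>l\<close> is 0, but the one at \<open>l - axis k 1\<close> need not be. If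
  \<open>k\<close> is not in \<open>nsupp u\<close>, such a fall leaves the support and both sides
  are 0.\<close>

lemma ext_coeff_minus_axis:
  assumes "u $ k + of_int (l $ k) = 0 \<Longrightarrow> k \<notin> nsupp u"
  shows "ext_coeff u (l - axis k 1) = (u $ k + of_int (l $ k)) * ext_coeff u l"
proof (cases "u $ k + of_int (l $ k) = 0")
  case True
  have "k \<in> nsupp (u + cvec (l - axis k 1))"
    unfolding nsupp_cvec using True by (intro exI[of _ "-1"]) (simp add: axis_def algebra_simps)
  then show ?thesis
    using True assms by (auto simp: ext_coeff_def)
next
  case False
  have "phi_coeff u (l - axis k 1)
      = shift_coeff (u $ k) (l $ k - 1) * (\<Prod>i\<in>UNIV - {k}. shift_coeff (u $ i) ((l - axis k 1) $ i))"
    unfolding phi_coeff_eq_prod by (subst prod.remove[of _ k]) (auto simp: axis_def)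
  also have "(\<Prod>i\<in>UNIV - {k}. shift_coeff (u $ i) ((l - axis k 1) $ i))
      = (\<Prod>i\<in>UNIV - {k}. shift_coeff (u $ i) (l $ i))"
    by (rule prod.cong) (auto simp: axis_def)
  also have "shift_coeff (u $ k) (l $ k - 1) * \<dots> = (u $ k + of_int (l $ k)) * phi_coeff u l"
    unfolding phi_coeff_eq_prod shift_coeff_minus_1[OF False]
    by (subst prod.remove[of UNIV k "\<lambda>i. shift_coeff (u $ i) (l $ i)"]) auto
  finally show ?thesis
    using nsupp_minus_axis[OF False] by (simp add: ext_coeff_def)
qed

definition int_vec :: "nat^'n::finite \<Rightarrow> int^'n" where
  "int_vec m = (\<chi> j. int (m $ j))"

text \<open>Suppose coordinate \<open>j\<close> falls from 0 to -1 and the new exponent has negative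
  support \<open>{j}\<close>. Adding \<open>m\<close> back creates no negative integers elsewhere,
  and entry \<open>j\<close> of \<open>u + cvec l\<close> is \<open>m $ j\<close>, hence
  nonnegative. So \<open>u + cvec l\<close> would have empty negative support, contrary to
  \<open>ne\<close>.\<close>

lemma ext_coeff_minus:
  assumes j: "nsupp u = {j}" and ne: "nsupp (u + cvec l) \<noteq> {}"
  shows "ext_coeff u (l - int_vec m - axis k 1)
    = (u $ k + of_int ((l - int_vec m) $ k)) * ext_coeff u (l - int_vec m)"
proof (cases "u $ k + of_int ((l - int_vec m) $ k) = 0 \<and> k = j")
  case True
  then have uk: "u $ j + of_int (l $ j) = of_int (int (m $ j))" and k: "k = j"
    by (auto simp: int_vec_def algebra_simps)
  have "nsupp (u + cvec (l - int_vec m - axis j 1)) \<noteq> {j}"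
  proof
    assume eq: "nsupp (u + cvec (l - int_vec m - axis j 1)) = {j}"
    have "i \<notin> nsupp (u + cvec l)" for i
    proof (cases "i = j")
      case True
      then show ?thesis using uk unfolding nsupp_cvec by (metis of_int_eq_iff of_nat_0_le_iff not_less)
    next
      case False
      then have "i \<notin> nsupp (u + cvec (l - int_vec m))"
        using eq nsupp_minus_axis_other[OF False, of u "l - int_vec m"] by auto
      then have *: "u $ i + of_int (l $ i) - of_nat (m $ i) \<noteq> of_int p" if "p < 0" for p
        using that unfolding nsupp_cvec by (auto simp: int_vec_def algebra_simps)
      show ?thesis
      proof
        assume "i \<in> nsupp (u + cvec l)"
        then obtain p where "p < 0" "u $ i + of_int (l $ i) = of_int p"
          unfolding nsupp_cvec by blast
        then show False using *[of "p - int (m $ i)"] by simp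
      qed
    qed
    then show False using ne by blast
  qed
  then show ?thesis
    using True k j by (simp add: ext_coeff_def)
next
  case False
  then show ?thesis
    by (intro ext_coeff_minus_axis) (use j in auto)
qed

lemma cvec_add [simp]: "cvec (a + b) = cvec a + cvec b"
  and cvec_diff [simp]: "cvec (a - b) = cvec a - cvec b"
  and cvec_axis [simp]: "cvec (axis k 1) = axis k 1"
  and cvec_0 [simp]: "cvec 0 = 0"
  by (auto simp: cvec_def vec_eq_iff axis_def)

lemma int_vec_add_axis: "int_vec (m + axis k 1) = int_vec m + axis k 1"
  by (auto simp: int_vec_def vec_eq_iff axis_def)

lemma int_vec_0: "int_vec 0 = 0"
  by (simp add: int_vec_def vec_eq_iff)

lemma normal_series_pd_monom:
  assumes j: "nsupp u = {j}" and ne: "\<And>l. l \<in> I \<Longrightarrow> nsupp (u + cvec l) \<noteq> {}"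
    and L: "log_branch L (ball q \<epsilon>)"
    and s: "normal_series I (\<lambda>l x. ext_coeff u l * monomial L (u + cvec l) x) f q \<epsilon>"
  shows "\<exists>\<epsilon>'>0. \<epsilon>' \<le> \<epsilon> \<and> normal_series I
     (\<lambda>l x. ext_coeff u (l - int_vec m) * monomial L (u + cvec (l - int_vec m)) x) (pd_monom m f) q \<epsilon>'"
proof (induction m rule: nat_vec_induct)
  case zero
  then show ?case
    using s by (intro exI[of _ \<epsilon>]) (auto simp: int_vec_0 pd_monom_0 normal_series_def)
next
  case (add_axis m k)
  then obtain \<epsilon>' where \<epsilon>': "0 < \<epsilon>'" "\<epsilon>' \<le> \<epsilon>" and s': "normal_series I
     (\<lambda>l x. ext_coeff u (l - int_vec m) * monomial L (u + cvec (l - int_vec m)) x) (pd_monom m f) q \<epsilon>'"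
    by blast
  have sub: "ball q (\<epsilon>' / 2) \<subseteq> ball q \<epsilon>" using \<epsilon>' by (intro subset_ball) simp
  have f: "f sep_holomorphic_on ball q \<epsilon>" by (rule normal_series_sep_holomorphic[OF s])
  have "normal_series I (\<lambda>l x. ext_coeff u (l - int_vec (m + axis k 1))
      * monomial L (u + cvec (l - int_vec (m + axis k 1))) x) (pd_monom (m + axis k 1) f) q (\<epsilon>' / 2)"
  proof (rule normal_series_cong[OF normal_series_pd[OF s', of k]])
    fix x assume "x \<in> ball q (\<epsilon>' / 2)"
    then have x: "x \<in> ball q \<epsilon>" using sub by blast
    then show "pd k (pd_monom m f) x = pd_monom (m + axis k 1) f x"
      using pd_monom_add_axis[OF f open_ball] by simp
    fix l assume l: "l \<in> I"
    have "pd k (\<lambda>x. ext_coeff u (l - int_vec m) * monomial L (u + cvec (l - int_vec m)) x) x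
        = ext_coeff u (l - int_vec m) * ((u + cvec (l - int_vec m)) $ k
          * monomial L (u + cvec (l - int_vec m) - axis k 1) x)"
      using pd_cmult[OF sep_holomorphic_monomial[OF L] x] pd_monomial_eq[OF L open_ball x] by simp
    also have "\<dots> = ext_coeff u (l - int_vec m - axis k 1)
          * monomial L (u + cvec (l - int_vec m) - axis k 1) x"
      using ext_coeff_minus[OF j ne[OF l], of m k] by (simp add: cvec_def)
    finally show "pd k (\<lambda>x. ext_coeff u (l - int_vec m) * monomial L (u + cvec (l - int_vec m)) x) x
        = ext_coeff u (l - int_vec (m + axis k 1)) * monomial L (u + cvec (l - int_vec (m + axis k 1))) x"
      by (simp add: int_vec_add_axis[unfolded One_nat_def] diff_diff_eq algebra_simps)
  qed
  then show ?case using \<epsilon>' by (intro exI[of _ "\<epsilon>' / 2"]) auto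
qed


section \<open>Normal convergence of the logarithm-free series\<close>

text \<open>For integral \<open>l\<close> the modulus of x^l depends only on the moduli of the
  coordinates; the branch enters only through the fixed factor x^u.\<close>

lemma norm_monomial_cvec:
  assumes L: "log_branch L U" and x: "x \<in> U"
  shows "norm (monomial L (u + cvec l) x)
    = norm (monomial L u x) * exp (\<Sum>k\<in>UNIV. of_int (l $ k) * ln (norm (x $ k)))"
proof -
  have "Re (L x $ k) = ln (norm (x $ k))" for k
    using L x unfolding log_branch_def by (metis ln_exp norm_exp_eq_Re)
  then have "norm (exp (\<Sum>k\<in>UNIV. of_int (l $ k) * L x $ k))
      = exp (\<Sum>k\<in>UNIV. of_int (l $ k) * ln (norm (x $ k)))"
    by (simp add: norm_exp_eq_Re)
  moreover have "monomial L (u + cvec l) x = monomial L u x * exp (\<Sum>k\<in>UNIV. of_int (l $ k) * L x $ k)"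
    by (simp add: monomial_def cvec_def distrib_right sum.distrib exp_add)
  ultimately show ?thesis by (simp add: norm_mult)
qed

text \<open>The moduli \<open>|x\<^sup>l|\<close> on a small polydisc around \<open>q\<close> are bounded by those at the corner points
  \<open>(q\<^sub>k e\<^bsup>\<plusminus>\<delta>\<^esup>)\<^sub>k\<close>, so pointwise absolute convergence implies normal convergence.\<close>

lemma phi_sum_normal_series:
  assumes "phi_sum A u q f"
  obtains \<epsilon> L where "log_branch L (ball q \<epsilon>)"
    "normal_series {l. A *v l = 0} (\<lambda>l x. ext_coeff u l * monomial L (u + cvec l) x) f q \<epsilon>"
proof -
  obtain \<epsilon>0 L where \<epsilon>0: "\<epsilon>0 > 0"
    and L_hol: "\<And>j. (\<lambda>x. L x $ j) mholomorphic_on ball q \<epsilon>0"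
    and L_exp: "\<And>x j. x \<in> ball q \<epsilon>0 \<Longrightarrow> exp (L x $ j) = x $ j"
    and hs: "\<And>x. x \<in> ball q \<epsilon>0 \<Longrightarrow>
       ((\<lambda>l. phi_coeff u l * exp (\<Sum>j\<in>UNIV. (u + cvec l) $ j * L x $ j)) has_sum f x) (same_nsupp A u)"
    using assms unfolding phi_sum_def by (elim exE conjE) blast
  have L: "log_branch L (ball q \<epsilon>0)"
    unfolding log_branch_def using L_hol L_exp mholomorphic_imp_sep_holomorphic by blast
  define N where "N = same_nsupp A u"
  define \<Lambda> where "\<Lambda> = {l. A *v l = 0}"
  have N: "N \<subseteq> \<Lambda>" by (auto simp: N_def \<Lambda>_def same_nsupp_def)
  have ext: "ext_coeff u l = phi_coeff u l" if "l \<in> N" for l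
    using that by (simp add: N_def same_nsupp_def ext_coeff_def)
  have ext0: "ext_coeff u l = 0" if "l \<in> \<Lambda> - N" for l
    using that by (simp add: N_def \<Lambda>_def same_nsupp_def ext_coeff_def)
  define T where "T l x = ext_coeff u l * monomial L (u + cvec l) x" for l x
  \<comment> \<open>The sum is extended from the support to the whole lattice by zero
    coefficients.\<close>
  have hs\<Lambda>: "((\<lambda>l. T l x) has_sum f x) \<Lambda>" if "x \<in> ball q \<epsilon>0" for x
  proof -
    have "((\<lambda>l. T l x) has_sum f x) \<Lambda> \<longleftrightarrow>
        ((\<lambda>l. phi_coeff u l * exp (\<Sum>j\<in>UNIV. (u + cvec l) $ j * L x $ j)) has_sum f x) N"
      using N ext ext0 by (intro has_sum_cong_neutral) (auto simp: T_def monomial_def)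
    with hs[OF that] show ?thesis by (simp add: N_def)
  qed
  define g where "g x l = norm (ext_coeff u l) * exp (\<Sum>k\<in>UNIV. of_int (l $ k) * ln (norm (x $ k)))"
    for x :: "complex^'a" and l
  have normT: "norm (T l x) = norm (monomial L u x) * g x l" if "x \<in> ball q \<epsilon>0" for x l
    using norm_monomial_cvec[OF L that, of u l] by (simp add: T_def g_def norm_mult)
  have g_summable: "g x summable_on \<Lambda>" if "x \<in> ball q \<epsilon>0" for x
  proof -
    have "(\<lambda>l. T l x) summable_on \<Lambda>" using hs\<Lambda>[OF that] by (rule has_sum_imp_summable)
    then have "(\<lambda>l. norm (T l x)) summable_on \<Lambda>"
      by (simp add: summable_on_iff_abs_summable_on_complex)
    then have "(\<lambda>l. norm (monomial L u x) * g x l) summable_on \<Lambda>"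
      by (simp add: normT[OF that])
    then show ?thesis
      using summable_on_cmult_right'[of "norm (monomial L u x)" "g x" \<Lambda>] monomial_nonzero by auto
  qed
  obtain \<rho> where \<rho>: "\<rho> > 0" "polydisc q \<rho> \<subseteq> ball q \<epsilon>0"
    using polydisc_subset[of "ball q \<epsilon>0" q] \<epsilon>0 by auto
  have q: "q \<in> ball q \<epsilon>0" using \<epsilon>0 by simp
  have q_nz: "q $ k \<noteq> 0" for k using log_branch_nonzero[OF L q] .
  have "\<forall>\<^sub>F \<delta> in at_right 0. \<forall>k\<in>UNIV. dist (q $ k * of_real (exp \<delta>)) (q $ k) < \<rho>
      \<and> dist (q $ k * of_real (exp (- \<delta>))) (q $ k) < \<rho>"
  proof (intro eventually_ball_finite ballI eventually_conj)
    fix k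
    have "((\<lambda>\<delta>. q $ k * of_real (exp \<delta>)) \<longlongrightarrow> q $ k * of_real (exp 0)) (at_right (0::real))"
      by (intro tendsto_intros)
    then show "\<forall>\<^sub>F \<delta> in at_right 0. dist (q $ k * of_real (exp \<delta>)) (q $ k) < \<rho>"
      using tendstoD \<rho>(1) by fastforce
    have "((\<lambda>\<delta>. q $ k * of_real (exp (- \<delta>))) \<longlongrightarrow> q $ k * of_real (exp (- 0))) (at_right (0::real))"
      by (intro tendsto_intros)
    then show "\<forall>\<^sub>F \<delta> in at_right 0. dist (q $ k * of_real (exp (- \<delta>))) (q $ k) < \<rho>"
      using tendstoD \<rho>(1) by fastforce
  qed auto
  moreover have "\<forall>\<^sub>F \<delta> in at_right (0::real). \<delta> > 0"
    by (simp add: eventually_at_right_less)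
  ultimately have "\<forall>\<^sub>F \<delta> in at_right (0::real). \<delta> > 0 \<and>
      (\<forall>k. dist (q $ k * of_real (exp \<delta>)) (q $ k) < \<rho> \<and> dist (q $ k * of_real (exp (- \<delta>))) (q $ k) < \<rho>)"
    by eventually_elim auto
  then obtain \<delta> :: real where \<delta>: "\<delta> > 0"
    "\<And>k. dist (q $ k * of_real (exp \<delta>)) (q $ k) < \<rho>" "\<And>k. dist (q $ k * of_real (exp (- \<delta>))) (q $ k) < \<rho>"
    using eventually_happens'[OF trivial_limit_at_right_real] by blast
  define c where "c S = (\<chi> k. q $ k * of_real (exp (if k \<in> S then \<delta> else - \<delta>)))" for S
  have c: "c S \<in> ball q \<epsilon>0" for S
    using \<rho>(2) \<delta>(2,3) by (intro subsetD[OF \<rho>(2)]) (simp add: polydisc_def c_def)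
  have ln_c: "ln (norm (c S $ k)) = ln (norm (q $ k)) + (if k \<in> S then \<delta> else - \<delta>)" for S k
    using q_nz[of k] by (simp add: c_def norm_mult ln_mult)
  define C where "C = norm (monomial L u q) + 1"
  \<comment> \<open>Which corner dominates depends on the signs of \<open>l\<close>, so the majorant
    adds up all corners. \<open>C\<close> bounds the common factor x^u near
    \<open>q\<close>.\<close>
  define M where "M l = C * (\<Sum>S\<in>UNIV. g (c S) l)" for l
  have M: "M summable_on \<Lambda>"
  proof -
    have "(\<lambda>l. \<Sum>S\<in>F. g (c S) l) summable_on \<Lambda>" if "finite F" for F
      using that
    proof induction
      case (insert S F)
      then show ?case
        using summable_on_add[OF g_summable[OF c[of S]] insert.IH] by simp
    qed simp
    then show ?thesis unfolding M_def[abs_def] by (intro summable_on_cmult_right) simp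
  qed
  have "\<forall>\<^sub>F x in nhds q. (\<forall>k\<in>UNIV. dist (ln (norm (x $ k))) (ln (norm (q $ k))) < \<delta>)
      \<and> norm (monomial L u x) < C \<and> x \<in> ball q \<epsilon>0"
  proof (intro eventually_conj eventually_ball_finite ballI)
    fix k
    have "((\<lambda>x. ln (norm (x $ k))) \<longlongrightarrow> ln (norm (q $ k))) (nhds q)"
      using q_nz by (intro tendsto_intros) (auto simp: filterlim_ident)
    then show "\<forall>\<^sub>F x in nhds q. dist (ln (norm (x $ k))) (ln (norm (q $ k))) < \<delta>"
      using \<delta>(1) by (rule tendstoD)
  next
    have "continuous_on (ball q \<epsilon>0) (monomial L u)"
      using sep_holomorphic_monomial[OF L] unfolding sep_holomorphic_on_def by blast
    then have "isCont (monomial L u) q"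
      using q by (simp add: continuous_on_eq_continuous_at)
    then have "(monomial L u \<longlongrightarrow> monomial L u q) (nhds q)"
      by (simp add: isCont_def tendsto_at_iff_tendsto_nhds)
    then have "((\<lambda>x. norm (monomial L u x)) \<longlongrightarrow> norm (monomial L u q)) (nhds q)"
      by (rule tendsto_norm)
    then show "\<forall>\<^sub>F x in nhds q. norm (monomial L u x) < C"
      by (rule order_tendstoD) (simp add: C_def)
  qed (use eventually_nhds_in_open[OF open_ball q] in auto)
  then obtain \<epsilon> where \<epsilon>: "\<epsilon> > 0" and near: "\<And>x. x \<in> ball q \<epsilon> \<Longrightarrow>
      (\<forall>k. dist (ln (norm (x $ k))) (ln (norm (q $ k))) < \<delta>) \<and> norm (monomial L u x) < C \<and> x \<in> ball q \<epsilon>0"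
    unfolding eventually_nhds_metric by (auto simp: dist_commute)
  have bound: "norm (T l x) \<le> M l" if x: "x \<in> ball q \<epsilon>" for l x
  proof -
    define S where "S = {k. l $ k \<ge> 0}"
    have "(\<Sum>k\<in>UNIV. of_int (l $ k) * ln (norm (x $ k))) \<le> (\<Sum>k\<in>UNIV. of_int (l $ k) * ln (norm (c S $ k)))"
    proof (rule sum_mono)
      fix k
      have "\<bar>ln (norm (x $ k)) - ln (norm (q $ k))\<bar> < \<delta>"
        using near[OF x] by (simp add: dist_real_def)
      then show "of_int (l $ k) * ln (norm (x $ k)) \<le> of_int (l $ k) * ln (norm (c S $ k))"
        unfolding ln_c by (cases "l $ k \<ge> 0") (auto simp: S_def intro: mult_left_mono mult_left_mono_neg)
    qed
    then have "g x l \<le> g (c S) l"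
      unfolding g_def by (intro mult_left_mono) auto
    also have "\<dots> \<le> (\<Sum>S\<in>UNIV. g (c S) l)"
      by (rule member_le_sum) (auto simp: g_def)
    finally have "norm (monomial L u x) * g x l \<le> C * (\<Sum>S\<in>UNIV. g (c S) l)"
      using near[OF x] by (intro mult_mono) (auto simp: g_def C_def)
    then show ?thesis using normT near[OF x] by (simp add: M_def)
  qed
  have sub: "ball q \<epsilon> \<subseteq> ball q \<epsilon>0" using near by blast
  have L': "log_branch L (ball q \<epsilon>)" using L sub by (rule log_branch_subset)
  have "normal_series \<Lambda> T f q \<epsilon>"
    unfolding normal_series_def
  proof (intro conjI exI[of _ M] ballI)
    show "T l sep_holomorphic_on ball q \<epsilon>" for l
      unfolding T_def[abs_def] by (intro sep_holomorphic_cmult sep_holomorphic_monomial[OF L'])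
  qed (use \<epsilon> M bound hs\<Lambda> sub in auto)
  then show thesis
    using that[OF L'] unfolding T_def[abs_def] \<Lambda>_def by blast
qed


section \<open>Lattice points\<close>

lemma int_cone_trivial:
  fixes a b s t :: int
  assumes "a > 0" "b > 0" "s \<ge> 0" "t \<ge> 0" "a * s + b * t \<le> 0"
  shows "s = 0 \<and> t = 0"
proof -
  have "a * s \<ge> 0" "b * t \<ge> 0" using assms by simp_all
  then have "a * s = 0" "b * t = 0" using assms by linarith+
  then show ?thesis using assms by simp
qed

text \<open>Each closed quadrant of the (s, t)-plane is met by one row that is negative on it away
  from the origin: \<open>c\<close> for the first, \<open>b\<close> for s >= 0 >= t,
  \<open>a\<close> for the third, \<open>d\<close> for s <= 0 <= t.\<close>

lemma four_quadrants_trivial: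
  fixes a1 a2 b1 b2 c1 c2 d1 d2 s t :: int
  assumes "a1 > 0" "a2 > 0" "b1 < 0" "b2 > 0" "c1 < 0" "c2 < 0" "d1 > 0" "d2 < 0"
    and "a1 * s + a2 * t \<ge> 0" "b1 * s + b2 * t \<ge> 0" "c1 * s + c2 * t \<ge> 0" "d1 * s + d2 * t \<ge> 0"
  shows "s = 0 \<and> t = 0"
proof -
  consider "s \<ge> 0" "t \<ge> 0" | "s \<le> 0" "t \<le> 0" | "s \<le> 0" "t \<ge> 0" | "s \<ge> 0" "t \<le> 0" by linarith
  then show ?thesis
  proof cases
    case 1 then show ?thesis using int_cone_trivial[of "- c1" "- c2" s t] assms by simp
  next
    case 2 then show ?thesis using int_cone_trivial[of a1 a2 "- s" "- t"] assms by simp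
  next
    case 3 then show ?thesis using int_cone_trivial[of d1 "- d2" "- s" t] assms by simp
  next
    case 4 then show ?thesis using int_cone_trivial[of "- b1" b2 s "- t"] assms by simp
  qed
qed

lemma int_mult_le_neg:
  fixes a s :: int
  assumes "a > 0" "s \<le> - 1"
  shows "a * s \<le> - a"
  using mult_left_mono[of s "-1" a] assms by simp

text \<open>The constants are the entries of \<open>v_int - axis j3 1\<close> at \<open>j1\<close>,
  \<open>j2\<close>, \<open>j3\<close>, \<open>j4\<close>. Integrality splits each of s, t into >= 0
  and <= -1, and in each of the four parts one of the expressions is at most -1.\<close>

lemma four_quadrants_hole:
  fixes a1 a2 b1 b2 c1 c2 d1 d2 s t :: int
  assumes "a1 > 0" "a2 > 0" "b1 < 0" "b2 > 0" "c1 < 0" "c2 < 0" "d1 > 0" "d2 < 0"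
    and h: "a1 + a2 - 1 + (a1 * s + a2 * t) \<ge> 0" "b2 - 1 + (b1 * s + b2 * t) \<ge> 0"
      "- 1 + (c1 * s + c2 * t) \<ge> 0" "d1 - 1 + (d1 * s + d2 * t) \<ge> 0"
  shows False
proof -
  consider "s \<ge> 0" "t \<ge> 0" | "s \<le> -1" "t \<le> -1" | "s \<le> -1" "t \<ge> 0" | "s \<ge> 0" "t \<le> -1" by linarith
  then show ?thesis
  proof cases
    case 1
    then have "c1 * s \<le> 0" "c2 * t \<le> 0" using assms by (auto intro: mult_nonpos_nonneg)
    then show False using h by linarith
  next
    case 2 then show False using int_mult_le_neg[of a1 s] int_mult_le_neg[of a2 t] assms by linarith
  next
    case 3
    then have "d2 * t \<le> 0" using assms by (auto intro: mult_nonpos_nonneg)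
    then show False using int_mult_le_neg[of d1 s] 3 assms by linarith
  next
    case 4
    then have "b1 * s \<le> 0" using assms by (auto intro: mult_nonpos_nonneg)
    then show False using int_mult_le_neg[of b2 t] 4 assms by linarith
  qed
qed

lemma not_Rats_add_of_int: "a \<notin> \<rat> \<Longrightarrow> a + of_int n \<noteq> (of_int m :: complex)"
  by (metis Rats_diff Rats_of_int add_diff_cancel_right')

lemma has_sum_sum:
  fixes f :: "'i \<Rightarrow> 'a \<Rightarrow> complex"
  assumes "finite I" "\<And>i. i \<in> I \<Longrightarrow> (f i has_sum s i) S"
  shows "((\<lambda>x. \<Sum>i\<in>I. f i x) has_sum (\<Sum>i\<in>I. s i)) S"
  using assms by (induction I rule: finite_induct) (auto intro: has_sum_add)


section \<open>Euler relations for derivatives\<close>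

text \<open>Moving the weighted Euler operator past one derivative in the variable \<open>t\<close>
  lowers its eigenvalue by \<open>c t\<close>.\<close>

lemma euler_pd_monom:
  assumes \<psi>: "\<psi> sep_holomorphic_on U" and U: "open U"
    and eq: "\<And>x. x \<in> U \<Longrightarrow> (\<Sum>k\<in>UNIV. c k * (x $ k * pd k \<psi> x)) = s * \<psi> x" and x: "x \<in> U"
  shows "(\<Sum>k\<in>UNIV. c k * (x $ k * pd k (pd_monom m \<psi>) x))
    = (s - (\<Sum>k\<in>UNIV. c k * of_nat (m $ k))) * pd_monom m \<psi> x"
  using x
proof (induction m arbitrary: x rule: nat_vec_induct)
  case zero
  then show ?case using eq by (simp add: pd_monom_0)
next
  case (add_axis m t)
  note x = add_axis.prems
  define \<chi>' where "\<chi>' = pd_monom m \<psi>"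
  define s' where "s' = s - (\<Sum>k\<in>UNIV. c k * of_nat (m $ k))"
  have hol: "\<chi>' sep_holomorphic_on U"
    unfolding \<chi>'_def by (rule weyl_sep_holomorphic[OF weyl_pd_monom \<psi> U])
  have hol_pd: "pd k \<chi>' sep_holomorphic_on U" for k by (rule sep_holomorphic_pd[OF hol U])
  have hol_x: "(\<lambda>x. x $ k * pd k \<chi>' x) sep_holomorphic_on U" for k
    by (intro sep_holomorphic_mult sep_holomorphic_coordinate hol_pd)
  have next_pd: "pd_monom (m + axis t 1) \<psi> y = pd t \<chi>' y" if "y \<in> U" for y
    unfolding \<chi>'_def using pd_monom_add_axis[OF \<psi> U that] by simp
  have "pd t (\<lambda>x. \<Sum>k\<in>UNIV. c k * (x $ k * pd k \<chi>' x)) x = pd t (\<lambda>x. s' * \<chi>' x) x"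
    using add_axis.IH by (intro weyl_cong[OF weyl.pd U _ x]) (simp add: \<chi>'_def s'_def)
  also have "\<dots> = s' * pd t \<chi>' x"
    by (rule pd_cmult[OF hol x])
  also have "pd t (\<lambda>x. \<Sum>k\<in>UNIV. c k * (x $ k * pd k \<chi>' x)) x
      = (\<Sum>k\<in>UNIV. c k * ((if k = t then 1 else 0) * pd k \<chi>' x + x $ k * pd t (pd k \<chi>') x))"
    by (simp add: pd_sum[of UNIV "\<lambda>k x. c k * (x $ k * pd k \<chi>' x)", OF sep_holomorphic_cmult[OF hol_x] x]
        pd_cmult[OF hol_x x] pd_mult[OF sep_holomorphic_coordinate hol_pd x] pd_coordinate)
  also have "\<dots> = c t * pd t \<chi>' x + (\<Sum>k\<in>UNIV. c k * (x $ k * pd k (pd t \<chi>') x))"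
    by (simp add: distrib_left sum.distrib pd_commute[OF hol U x, of t] if_distrib[of "\<lambda>z. z * _"]
        if_distrib[of "\<lambda>z. c _ * z"] cong: if_cong)
  finally have "(\<Sum>k\<in>UNIV. c k * (x $ k * pd k (pd t \<chi>') x)) = (s' - c t) * pd t \<chi>' x"
    by (simp add: algebra_simps)
  moreover have "pd k (pd_monom (m + axis t 1) \<psi>) x = pd k (pd t \<chi>') x" for k
    by (rule weyl_cong[OF weyl.pd U next_pd x])
  moreover have "(\<Sum>k\<in>UNIV. c k * of_nat ((m + axis t 1) $ k)) = (\<Sum>k\<in>UNIV. c k * of_nat (m $ k)) + c t"
    by (simp add: distrib_left sum.distrib axis_def if_distrib[of of_nat] if_distrib[of "\<lambda>z. c _ * z"] cong: if_cong)
  ultimately show ?case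
    using next_pd[OF x] by (simp only: s'_def diff_diff_eq)
qed


section \<open>The annihilating operators\<close>

locale codim_two =
  fixes A :: "int^'n::finite^'d::finite" and B :: "int^2^'n" and j1 j2 j3 j4 :: 'n and \<alpha> :: "complex^'n"
  assumes cols: "\<And>y. \<exists>u. A *v u = y"
    and basis: "bij_betw (\<lambda>z. B *v z) UNIV {u. A *v u = 0}"
    and indices: "distinct [j1, j2, j3, j4]"
    and row1: "B $ j1 $ 1 > 0" "B $ j1 $ 2 > 0"
    and row2: "B $ j2 $ 1 < 0" "B $ j2 $ 2 > 0"
    and row3: "B $ j3 $ 1 < 0" "B $ j3 $ 2 < 0"
    and row4: "B $ j4 $ 1 > 0" "B $ j4 $ 2 < 0"
    and irrational: "\<And>i. i \<notin> {j1, j2, j3, j4} \<Longrightarrow> \<alpha> $ i \<notin> \<rat>"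
begin

definition J :: "'n set" where "J = {j1, j2, j3, j4}"

definition v_int :: "int^'n" where
  "v_int = pos_part (column 1 B) + pos_part (column 2 B) - axis j1 1 - axis j2 1 - axis j4 1"

definition v :: "complex^'n" where
  "v = cvec v_int + (\<chi> i. if i \<in> J then 0 else \<alpha> $ i)"

definition \<Lambda> :: "(int^'n) set" where "\<Lambda> = {l. A *v l = 0}"

text \<open>The exponent of \<open>\<phi>\<^sub>i\<close> is \<open>start i = v - e\<^sub>3 - \<delta> i\<close>. The monomials are chosen such that
  \<open>m i = M + e\<^sub>i - e\<^sub>3 - \<delta> i\<close> has no negative entries, so that \<open>\<partial>\<^bsup>m i\<^esup> \<partial>\<^sub>3\<close> and \<open>\<partial>\<^sup>M \<partial>\<^sub>i\<close>
  are congruent modulo the toric ideal, and such that \<open>y0 = v - M\<close> vanishes on \<open>J\<close>.\<close>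

definition \<delta> :: "'n \<Rightarrow> int^'n" where
  "\<delta> i = (if i = j1 then column 1 B + column 2 B else if i = j2 then column 2 B
          else if i = j4 then column 1 B else 0)"

definition M :: "nat^'n" where
  "M = (\<chi> k. if k \<in> J then nat (v_int $ k) else nat (\<bar>B $ k $ 1\<bar> + \<bar>B $ k $ 2\<bar>))"

definition m :: "'n \<Rightarrow> nat^'n" where
  "m i = (\<chi> k. nat ((int_vec M + axis i 1 - axis j3 1 - \<delta> i) $ k))"

definition y0 :: "complex^'n" where "y0 = v - cvec (int_vec M)"

definition ann_op :: "int^'n \<Rightarrow> (complex^'n \<Rightarrow> complex) \<Rightarrow> complex^'n \<Rightarrow> complex" where
  "ann_op w f x = (\<Sum>i\<in>J. of_int (w $ i) * (x $ i * pd_monom (m i) f x))"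

definition left_kernel :: "(int^'n) set" where
  "left_kernel = {w. (\<forall>i. i \<notin> J \<longrightarrow> w $ i = 0) \<and> (\<forall>c. (\<Sum>k\<in>UNIV. w $ k * B $ k $ c) = 0)}"

definition start :: "'n \<Rightarrow> complex^'n" where
  "start i = v - axis j3 1 - cvec (\<delta> i)"

lemma distinct_J: "j1 \<noteq> j2" "j1 \<noteq> j3" "j1 \<noteq> j4" "j2 \<noteq> j3" "j2 \<noteq> j4" "j3 \<noteq> j4"
  "j2 \<noteq> j1" "j3 \<noteq> j1" "j4 \<noteq> j1" "j3 \<noteq> j2" "j4 \<noteq> j2" "j4 \<noteq> j3"
  using indices by auto

lemma weyl_ann_op: "ann_op w \<in> weyl"
proof -
  have "(\<lambda>f x. \<Sum>i\<in>J. of_int (w $ i) * (x $ i * pd_monom (m i) f x)) \<in> weyl"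
    by (intro weyl_sum weyl_cmult weyl_coordinate_mult weyl_pd_monom)
  then show ?thesis by (simp add: ann_op_def[abs_def])
qed

lemma \<Lambda>_column: "column c B \<in> \<Lambda>"
proof -
  have "column c B = B *v axis c 1"
    by (simp add: vec_eq_iff column_def matrix_vector_mult_def axis_def if_distrib cong: if_cong)
  then show ?thesis
    using bij_betw_imp_surj_on[OF basis] unfolding \<Lambda>_def by blast
qed

lemma \<Lambda>_add: "a \<in> \<Lambda> \<Longrightarrow> b \<in> \<Lambda> \<Longrightarrow> a + b \<in> \<Lambda>"
  and \<Lambda>_diff: "a \<in> \<Lambda> \<Longrightarrow> b \<in> \<Lambda> \<Longrightarrow> a - b \<in> \<Lambda>"
  and \<Lambda>_0: "0 \<in> \<Lambda>"
  by (auto simp: \<Lambda>_def matrix_vector_right_distrib matrix_vector_mult_diff_distrib)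

lemma \<Lambda>_\<delta>: "\<delta> i \<in> \<Lambda>"
  by (auto simp: \<delta>_def intro: \<Lambda>_add \<Lambda>_column \<Lambda>_0)

lemma \<Lambda>_coordinates:
  assumes "l \<in> \<Lambda>"
  obtains s t where "\<And>k. l $ k = B $ k $ 1 * s + B $ k $ 2 * t"
proof -
  obtain z where "l = B *v z"
    using assms bij_betw_imp_surj_on[OF basis] unfolding \<Lambda>_def by blast
  then have "l $ k = B $ k $ 1 * z $ 1 + B $ k $ 2 * z $ 2" for k
    by (simp add: matrix_vector_mult_def sum_2)
  then show thesis using that by blast
qed

lemma \<Lambda>_nonneg_imp_0:
  assumes l: "l \<in> \<Lambda>" and pos: "\<And>i. i \<in> J \<Longrightarrow> l $ i \<ge> 0"
  shows "l = 0"
proof -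
  obtain s t where st: "\<And>k. l $ k = B $ k $ 1 * s + B $ k $ 2 * t"
    using \<Lambda>_coordinates[OF l] by blast
  have "s = 0 \<and> t = 0"
    using pos[of j1] pos[of j2] pos[of j3] pos[of j4] unfolding st J_def
    by (intro four_quadrants_trivial[OF row1 row2 row3 row4]) auto
  then show ?thesis using st by (simp add: vec_eq_iff)
qed

lemma left_kernel_orthogonal:
  assumes "w \<in> left_kernel" "l \<in> \<Lambda>"
  shows "(\<Sum>k\<in>UNIV. w $ k * l $ k) = 0"
proof -
  obtain s t where st: "\<And>k. l $ k = B $ k $ 1 * s + B $ k $ 2 * t"
    using \<Lambda>_coordinates[OF assms(2)] by blast
  have "(\<Sum>k\<in>UNIV. w $ k * l $ k)
      = (\<Sum>k\<in>UNIV. w $ k * B $ k $ 1) * s + (\<Sum>k\<in>UNIV. w $ k * B $ k $ 2) * t"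
    by (simp add: st distrib_left sum.distrib sum_distrib_right mult.assoc)
  then show ?thesis using assms(1) unfolding left_kernel_def by simp
qed

lemma sum_left_kernel:
  assumes "w \<in> left_kernel"
  shows "(\<Sum>k\<in>UNIV. of_int (w $ k) * f k) = (\<Sum>k\<in>J. of_int (w $ k) * (f k :: complex))"
  by (rule sum.mono_neutral_right) (use assms in \<open>auto simp: left_kernel_def\<close>)

text \<open>Since A is surjective over the integers, it has an integral right inverse, with columns
  \<open>\<sigma> i\<close>. Subtracting from the unit vector e_k the combination \<open>S\<close>
  of these columns with the same image leaves a kernel vector, to which \<open>w\<close> is
  orthogonal. This yields \<open>y i\<close> as the pairing of \<open>w\<close> with
  \<open>\<sigma> i\<close>, so that \<open>w\<close> combines the Euler operators of the
  system.\<close>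

lemma left_kernel_row_space:
  assumes w: "w \<in> left_kernel"
  obtains y :: "'d \<Rightarrow> int" where "\<And>k. w $ k = (\<Sum>i\<in>UNIV. y i * A $ i $ k)"
proof -
  have "\<forall>i. \<exists>u. A *v u = axis i 1" using cols by blast
  then obtain \<sigma> where \<sigma>: "\<And>i. A *v \<sigma> i = axis i 1" by metis
  have \<sigma>': "(\<Sum>k\<in>UNIV. A $ r $ k * \<sigma> i $ k) = (if r = i then 1 else 0)" for r i
    using arg_cong[OF \<sigma>[of i], of "\<lambda>u. u $ r"] by (simp add: matrix_vector_mult_def axis_def)
  define y where "y i = (\<Sum>k\<in>UNIV. w $ k * \<sigma> i $ k)" for i
  have "w $ k = (\<Sum>i\<in>UNIV. y i * A $ i $ k)" for k
  proof -
    define S where "S = (\<chi> k'. \<Sum>i\<in>UNIV. A $ i $ k * \<sigma> i $ k')"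
    have "(A *v S) $ r = A $ r $ k" for r
    proof -
      have "(A *v S) $ r = (\<Sum>k'\<in>UNIV. \<Sum>i\<in>UNIV. A $ i $ k * (A $ r $ k' * \<sigma> i $ k'))"
        by (simp add: matrix_vector_mult_def S_def sum_distrib_left mult.left_commute)
      also have "\<dots> = (\<Sum>i\<in>UNIV. A $ i $ k * (\<Sum>k'\<in>UNIV. A $ r $ k' * \<sigma> i $ k'))"
        by (subst sum.swap) (simp add: sum_distrib_left)
      also have "\<dots> = A $ r $ k"
        by (simp add: \<sigma>' if_distrib cong: if_cong)
      finally show ?thesis .
    qed
    moreover have "(A *v axis k 1) $ r = A $ r $ k" for r
      by (simp add: matrix_vector_mult_def axis_def if_distrib cong: if_cong)
    ultimately have "axis k 1 - S \<in> \<Lambda>"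
      by (simp add: \<Lambda>_def matrix_vector_mult_diff_distrib vec_eq_iff)
    then have "(\<Sum>k'\<in>UNIV. w $ k' * (axis k 1 - S) $ k') = 0"
      by (rule left_kernel_orthogonal[OF w])
    moreover have "(\<Sum>k'\<in>UNIV. w $ k' * axis k 1 $ k') = w $ k"
      by (simp add: axis_def if_distrib cong: if_cong)
    ultimately have "w $ k = (\<Sum>k'\<in>UNIV. w $ k' * S $ k')"
      by (simp add: right_diff_distrib sum_subtractf)
    also have "\<dots> = (\<Sum>k'\<in>UNIV. \<Sum>i\<in>UNIV. w $ k' * \<sigma> i $ k' * A $ i $ k)"
      by (simp add: S_def sum_distrib_left mult_ac)
    also have "\<dots> = (\<Sum>i\<in>UNIV. y i * A $ i $ k)"
      by (subst sum.swap) (simp add: y_def sum_distrib_right)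
    finally show ?thesis .
  qed
  then show thesis using that by blast
qed

lemma v_int_J:
  "v_int $ j1 = B $ j1 $ 1 + B $ j1 $ 2 - 1" "v_int $ j2 = B $ j2 $ 2 - 1"
  "v_int $ j3 = 0" "v_int $ j4 = B $ j4 $ 1 - 1"
  using row1 row2 row3 row4 distinct_J
  by (auto simp: v_int_def pos_part_def column_def axis_def)

text \<open>The truncation by \<open>nat\<close> in \<open>m\<close> changes nothing: on
  \<open>J\<close> the entries are nonnegative by the signs of the four rows, and off
  \<open>J\<close> the entries |b_k1| + |b_k2| of \<open>M\<close> dominate every
  \<open>\<delta> i\<close>.\<close>

lemma int_vec_m: "i \<in> J \<Longrightarrow> int_vec (m i) = int_vec M + axis i 1 - axis j3 1 - \<delta> i"
proof -
  assume i: "i \<in> J"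
  have "(int_vec M + axis i 1 - axis j3 1 - \<delta> i) $ k \<ge> 0" for k
  proof (cases "k \<in> J")
    case True
    then show ?thesis
      using i row1 row2 row3 row4 distinct_J
      by (auto simp: int_vec_def M_def J_def v_int_J \<delta>_def axis_def column_def)
  next
    case False
    then show ?thesis
      using i distinct_J by (auto simp: int_vec_def M_def J_def \<delta>_def axis_def column_def)
  qed
  then show ?thesis
    by (simp add: vec_eq_iff int_vec_def m_def)
qed

lemma y0_J: "i \<in> J \<Longrightarrow> y0 $ i = 0"
  using row1 row2 row3 row4
  by (auto simp: y0_def v_def cvec_def int_vec_def M_def J_def v_int_J)

lemma nsupp_start_add:
  "i \<in> nsupp (start j + cvec l) \<longleftrightarrow> i \<in> J \<and> v_int $ i - axis j3 1 $ i - \<delta> j $ i + l $ i < 0"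
proof (cases "i \<in> J")
  case True
  have "start j $ i + of_int (l $ i) = of_int (v_int $ i - axis j3 1 $ i - \<delta> j $ i + l $ i)"
    using True by (simp add: start_def v_def cvec_def axis_def)
  then show ?thesis
    using True unfolding nsupp_cvec by (metis of_int_eq_iff)
next
  case False
  have "start j $ i + of_int (l $ i) = \<alpha> $ i + of_int (v_int $ i - axis j3 1 $ i - \<delta> j $ i + l $ i)"
    using False by (simp add: start_def v_def cvec_def axis_def)
  then show ?thesis
    using False irrational[of i] not_Rats_add_of_int unfolding nsupp_cvec J_def by metis
qed

text \<open>The starting exponents differ by lattice vectors, so for all \<open>j\<close> the claim
  is that no lattice translate of v - e_3 is nonnegative on \<open>J\<close>. It supplies the
  premise \<open>ne\<close> for termwise differentiation.\<close>

lemma nsupp_start_nonempty: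
  assumes "l \<in> \<Lambda>"
  shows "nsupp (start j + cvec l) \<noteq> {}"
proof
  assume empty: "nsupp (start j + cvec l) = {}"
  have "l - \<delta> j \<in> \<Lambda>" using assms \<Lambda>_\<delta> by (rule \<Lambda>_diff)
  then obtain s t where st: "\<And>k. (l - \<delta> j) $ k = B $ k $ 1 * s + B $ k $ 2 * t"
    using \<Lambda>_coordinates by blast
  have "v_int $ i - axis j3 1 $ i + (B $ i $ 1 * s + B $ i $ 2 * t) \<ge> 0" if "i \<in> J" for i
    using nsupp_start_add[of i j l] empty that st[of i] by auto
  from this[of j1] this[of j2] this[of j3] this[of j4] show False
    using distinct_J v_int_J
    by (intro four_quadrants_hole[OF row1 row2 row3 row4, of s t]) (auto simp: J_def axis_def)
qed

text \<open>Subtracting \<open>\<delta> i\<close> makes entry \<open>i\<close> equal to -1 and keeps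
  the other entries in \<open>J\<close> nonnegative.\<close>

lemma nsupp_start:
  assumes "i \<in> J"
  shows "nsupp (start i) = {i}"
proof -
  have "nsupp (start i) = {k \<in> J. v_int $ k - axis j3 1 $ k - \<delta> i $ k < 0}"
    using nsupp_start_add[of _ i 0] by auto
  also have "\<dots> = {i}"
    using assms row1 row2 row3 row4 distinct_J
    by (auto simp: J_def \<delta>_def axis_def column_def v_int_J)
  finally show ?thesis .
qed


section \<open>The operators on the series\<close>

text \<open>The left-hand side is the coefficient of x^(y0+mu) in P_w phi_j. If
  \<open>\<mu> $ j\<close> is nonzero, all four coefficients arise from the one at
  \<open>\<tau> + \<mu>\<close> by differentiation, and orthogonality of \<open>w\<close> to
  \<open>\<mu>\<close> gives 0. Otherwise only the term \<open>i = j\<close> can survive, and only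
  if \<open>\<mu>\<close> is nonnegative on \<open>J\<close>, that is, zero.\<close>

lemma ann_op_start_coeff:
  assumes w: "w \<in> left_kernel" and j: "j \<in> J" and \<mu>: "\<mu> \<in> \<Lambda>"
    and \<tau>: "\<tau> = \<delta> j + axis j3 1 - int_vec M"
  shows "(\<Sum>i\<in>J. of_int (w $ i) * ext_coeff (start j) (\<tau> + \<mu> - axis i 1))
    = (if \<mu> = 0 then of_int (w $ j) * ext_coeff (start j) (\<tau> - axis j 1) else 0)"
proof -
  have ns: "nsupp (start j) = {j}" using nsupp_start[OF j] .
  \<comment> \<open>The vector \<open>start j + cvec \<tau>\<close> is \<open>y0\<close>, which
    vanishes on \<open>J\<close>.\<close>
  have val: "start j $ i + of_int ((\<tau> + \<mu>) $ i) = of_int (\<mu> $ i)" if "i \<in> J" for i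
    using y0_J[OF that] by (simp add: start_def y0_def \<tau> cvec_def axis_def)
  show ?thesis
  proof (cases "\<mu> $ j = 0")
    case False
    have "(\<Sum>i\<in>J. of_int (w $ i) * ext_coeff (start j) (\<tau> + \<mu> - axis i 1))
        = (\<Sum>i\<in>J. of_int (w $ i) * (of_int (\<mu> $ i) * ext_coeff (start j) (\<tau> + \<mu>)))"
    proof (rule sum.cong[OF refl])
      fix i assume i: "i \<in> J"
      have "ext_coeff (start j) (\<tau> + \<mu> - axis i 1) = of_int (\<mu> $ i) * ext_coeff (start j) (\<tau> + \<mu>)"
        unfolding val[OF i, symmetric]
        by (rule ext_coeff_minus_axis) (unfold val[OF i] ns, use False in auto)
      then show "of_int (w $ i) * ext_coeff (start j) (\<tau> + \<mu> - axis i 1)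
          = of_int (w $ i) * (of_int (\<mu> $ i) * ext_coeff (start j) (\<tau> + \<mu>))"
        by simp
    qed
    also have "\<dots> = (\<Sum>i\<in>J. of_int (w $ i) * of_int (\<mu> $ i)) * ext_coeff (start j) (\<tau> + \<mu>)"
      by (simp add: sum_distrib_right mult.assoc)
    also have "(\<Sum>i\<in>J. of_int (w $ i) * of_int (\<mu> $ i)) = (of_int (\<Sum>k\<in>UNIV. w $ k * \<mu> $ k) :: complex)"
      using sum_left_kernel[OF w, of "\<lambda>k. of_int (\<mu> $ k)"] by simp
    finally show ?thesis
      using left_kernel_orthogonal[OF w \<mu>] False by auto
  next
    \<comment> \<open>Coordinate \<open>j\<close> of the exponent is 0 here, so the term at
      \<open>\<tau> + \<mu>\<close> is missing from the series, and lowering \<open>j\<close> leads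
      to the exceptional fall to -1.\<close>
    case True
    have "j \<notin> nsupp (start j + cvec (\<tau> + \<mu>))"
      unfolding nsupp_cvec val[OF j] using True by auto
    then have c0: "ext_coeff (start j) (\<tau> + \<mu>) = 0"
      using ns by (auto simp: ext_coeff_def)
    have "ext_coeff (start j) (\<tau> + \<mu> - axis i 1) = 0" if "i \<in> J" "i \<noteq> j" for i
      using ext_coeff_minus_axis[of "start j" i "\<tau> + \<mu>"] ns c0 that by simp
    then have "(\<Sum>i\<in>J. of_int (w $ i) * ext_coeff (start j) (\<tau> + \<mu> - axis i 1))
        = (\<Sum>i\<in>{j}. of_int (w $ i) * ext_coeff (start j) (\<tau> + \<mu> - axis i 1))"
      using j by (intro sum.mono_neutral_right) (auto simp: J_def)
    moreover have "ext_coeff (start j) (\<tau> + \<mu> - axis j 1) = 0" if "\<mu> \<noteq> 0"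
    proof -
      have "nsupp (start j + cvec (\<tau> + \<mu> - axis j 1)) \<noteq> {j}"
      proof
        assume eq: "nsupp (start j + cvec (\<tau> + \<mu> - axis j 1)) = {j}"
        have "\<mu> $ i \<ge> 0" if i: "i \<in> J" for i
        proof (cases "i = j")
          case False
          then have "i \<notin> nsupp (start j + cvec (\<tau> + \<mu>))"
            using nsupp_minus_axis_other[OF False, of "start j" "\<tau> + \<mu>"] eq by auto
          then show ?thesis
            unfolding nsupp_cvec val[OF i] by force
        qed (use True in simp)
        then have "\<mu> = 0" by (rule \<Lambda>_nonneg_imp_0[OF \<mu>])
        with \<open>\<mu> \<noteq> 0\<close> show False by simp
      qed
      then show ?thesis using ns by (simp add: ext_coeff_def)
    qed
    ultimately show ?thesis by auto
  qed
qed

text \<open>The exponent reached is \<open>y0 - axis j 1\<close>, whose entries on \<open>J\<close>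
  are -1 at \<open>j\<close> and 0 elsewhere, so its negative support is that of
  \<open>start j\<close>.\<close>

lemma ext_coeff_start_nonzero:
  assumes j: "j \<in> J"
  shows "ext_coeff (start j) (\<delta> j + axis j3 1 - int_vec M - axis j 1) \<noteq> 0"
proof (rule ext_coeff_nonzero)
  have M: "int (M $ i) = v_int $ i" if "i \<in> J" for i
    using that row1 row2 row3 row4 by (auto simp: M_def J_def v_int_J)
  have "i \<in> nsupp (start j + cvec (\<delta> j + axis j3 1 - int_vec M - axis j 1)) \<longleftrightarrow> i = j" for i
    unfolding nsupp_start_add using j M[of i] by (auto simp: int_vec_def axis_def)
  then show "nsupp (start j + cvec (\<delta> j + axis j3 1 - int_vec M - axis j 1)) = nsupp (start j)"
    using nsupp_start[OF j] by auto
qed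

lemma ann_op_phi_sum:
  assumes w: "w \<in> left_kernel" and j: "j \<in> J" and \<phi>: "phi_sum A (start j) q f"
  obtains \<epsilon> L K where "\<epsilon> > 0" "log_branch L (ball q \<epsilon>)" "K \<noteq> 0"
    "\<forall>\<^sub>F x in nhds q. ann_op w f x = of_int (w $ j) * (K * monomial L y0 x)"
proof -
  define u where "u = start j"
  define \<tau> where "\<tau> = \<delta> j + axis j3 1 - int_vec M"
  define K where "K = ext_coeff u (\<tau> - axis j 1)"
  obtain \<epsilon> L where L: "log_branch L (ball q \<epsilon>)"
    and s: "normal_series \<Lambda> (\<lambda>l x. ext_coeff u l * monomial L (u + cvec l) x) f q \<epsilon>"
    using phi_sum_normal_series[OF \<phi>] unfolding \<Lambda>_def u_def .
  have \<epsilon>: "\<epsilon> > 0" using s unfolding normal_series_def by blast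
  have "\<forall>\<^sub>F x in nhds q. ((\<lambda>l. ext_coeff u (l - int_vec (m i)) * monomial L (u + cvec (l - int_vec (m i))) x)
      has_sum pd_monom (m i) f x) \<Lambda>" for i
  proof -
    obtain \<epsilon>' where \<epsilon>': "\<epsilon>' > 0" and "normal_series \<Lambda>
       (\<lambda>l x. ext_coeff u (l - int_vec (m i)) * monomial L (u + cvec (l - int_vec (m i))) x) (pd_monom (m i) f) q \<epsilon>'"
      using normal_series_pd_monom[OF _ _ L s] nsupp_start[OF j] nsupp_start_nonempty unfolding u_def by blast
    then have "\<forall>x\<in>ball q \<epsilon>'. ((\<lambda>l. ext_coeff u (l - int_vec (m i)) * monomial L (u + cvec (l - int_vec (m i))) x)
        has_sum pd_monom (m i) f x) \<Lambda>"
      unfolding normal_series_def by blast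
    moreover have "\<forall>\<^sub>F x in nhds q. x \<in> ball q \<epsilon>'"
      using \<epsilon>' by (intro eventually_nhds_in_open) auto
    ultimately show ?thesis by (auto elim: eventually_mono)
  qed
  then have "\<forall>\<^sub>F x in nhds q. \<forall>i\<in>J. ((\<lambda>l. ext_coeff u (l - int_vec (m i)) * monomial L (u + cvec (l - int_vec (m i))) x)
      has_sum pd_monom (m i) f x) \<Lambda>"
    by (intro eventually_ball_finite) (auto simp: J_def)
  moreover have "\<forall>\<^sub>F x in nhds q. x \<in> ball q \<epsilon>"
    using \<epsilon> by (intro eventually_nhds_in_open) auto
  ultimately have "\<forall>\<^sub>F x in nhds q. ann_op w f x = of_int (w $ j) * (K * monomial L y0 x)"
  proof eventually_elim
    case (elim x)
    have "((\<lambda>\<mu>. of_int (w $ i) * (x $ i * (ext_coeff u (\<tau> + \<mu> - axis i 1)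
        * monomial L (y0 + cvec \<mu> - axis i 1) x))) has_sum of_int (w $ i) * (x $ i * pd_monom (m i) f x)) \<Lambda>"
      if i: "i \<in> J" for i
    proof (intro has_sum_cmult_right)
      \<comment> \<open>Translating the index by \<open>\<delta> j - \<delta> i\<close> makes the
        i-th series, once multiplied by x_i, run over the same exponents
        \<open>y0 + cvec \<mu>\<close> for every \<open>i\<close>.\<close>
      have bij: "bij_betw (\<lambda>\<mu>. \<mu> + (\<delta> j - \<delta> i)) \<Lambda> \<Lambda>"
        by (rule bij_betw_byWitness[where f' = "\<lambda>l. l - (\<delta> j - \<delta> i)"])
           (auto intro!: \<Lambda>_add \<Lambda>_diff \<Lambda>_\<delta>)
      have shift: "\<mu> + (\<delta> j - \<delta> i) - int_vec (m i) = \<tau> + \<mu> - axis i 1" for \<mu>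
        unfolding int_vec_m[OF i] \<tau>_def by (simp add: algebra_simps)
      have u: "u + cvec (\<tau> + \<mu> - axis i 1) = y0 + cvec \<mu> - axis i 1" for \<mu>
        by (simp add: u_def start_def \<tau>_def y0_def)
      show "((\<lambda>\<mu>. ext_coeff u (\<tau> + \<mu> - axis i 1) * monomial L (y0 + cvec \<mu> - axis i 1) x)
          has_sum pd_monom (m i) f x) \<Lambda>"
        using iffD2[OF has_sum_reindex_bij_betw[OF bij] bspec[OF elim(1) i]] by (simp only: shift u)
    qed
    moreover have "x $ i * (c * monomial L (y - axis i 1) x) = c * monomial L y x" for i c y
      using monomial_add_axis[OF L elim(2), of i "y - axis i 1"] by (simp add: mult.left_commute)
    ultimately have "((\<lambda>\<mu>. of_int (w $ i) * (ext_coeff u (\<tau> + \<mu> - axis i 1) * monomial L (y0 + cvec \<mu>) x))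
        has_sum of_int (w $ i) * (x $ i * pd_monom (m i) f x)) \<Lambda>" if "i \<in> J" for i
      using that by simp
    then have sum1: "((\<lambda>\<mu>. \<Sum>i\<in>J. of_int (w $ i) * (ext_coeff u (\<tau> + \<mu> - axis i 1) * monomial L (y0 + cvec \<mu>) x))
        has_sum ann_op w f x) \<Lambda>"
      unfolding ann_op_def by (intro has_sum_sum) (auto simp: J_def)
    have sum2: "(\<Sum>i\<in>J. of_int (w $ i) * (ext_coeff u (\<tau> + \<mu> - axis i 1) * monomial L (y0 + cvec \<mu>) x))
        = (if \<mu> = 0 then of_int (w $ j) * (K * monomial L y0 x) else 0)" if "\<mu> \<in> \<Lambda>" for \<mu>
    proof -
      have "(\<Sum>i\<in>J. of_int (w $ i) * (ext_coeff u (\<tau> + \<mu> - axis i 1) * monomial L (y0 + cvec \<mu>) x))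
          = (\<Sum>i\<in>J. of_int (w $ i) * ext_coeff u (\<tau> + \<mu> - axis i 1)) * monomial L (y0 + cvec \<mu>) x"
        by (simp add: sum_distrib_right mult.assoc)
      also have "\<dots> = (if \<mu> = 0 then of_int (w $ j) * (K * monomial L y0 x) else 0)"
        unfolding u_def ann_op_start_coeff[OF w j that \<tau>_def] by (simp add: K_def u_def)
      finally show ?thesis .
    qed
    have "((\<lambda>\<mu>. if \<mu> = 0 then of_int (w $ j) * (K * monomial L y0 x) else 0) has_sum ann_op w f x) \<Lambda>"
      using sum1 by (rule iffD1[OF has_sum_cong, rotated]) (rule sum2)
    moreover have "((\<lambda>\<mu>. if \<mu> = 0 then of_int (w $ j) * (K * monomial L y0 x) else 0)
        has_sum of_int (w $ j) * (K * monomial L y0 x)) \<Lambda>"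
      using \<Lambda>_0 by (intro has_sum_finite_neutralI[where B = "{0}"]) auto
    ultimately show ?case by (rule has_sum_unique)
  qed
  moreover have "K \<noteq> 0"
    using ext_coeff_start_nonzero[OF j] by (simp add: K_def u_def \<tau>_def)
  ultimately show thesis using that \<epsilon> L by blast
qed

section \<open>Passage from the series to the germ at \<open>p\<close>\<close>

text \<open>If \<open>w $ j = 0\<close>, the germ vanishes at \<open>q\<close> and this moves to
  \<open>p\<close>. Conversely, a bare value 0 at \<open>p\<close> has to be upgraded to a vanishing
  germ first: the eigenvalue equations are moved from \<open>q\<close> to \<open>p\<close>, where
  they force this. The vanishing then moves back to \<open>q\<close>, where the monomial has no
  zero.\<close>

lemma ann_op_is_phi:
  assumes w: "w \<in> left_kernel" and j: "j \<in> J" and \<phi>: "is_phi A (start j) p \<phi>"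
    and hol: "\<phi> sep_holomorphic_on ball p r" and r: "r > 0"
    and L: "log_branch L (ball p \<epsilon>)" and \<epsilon>: "\<epsilon> > 0"
  shows "ann_op w \<phi> p = 0 \<longleftrightarrow> w $ j = 0"
proof -
  obtain q g where g: "phi_sum A (start j) q g" and cont: "\<And>P. P \<in> weyl \<Longrightarrow>
      (\<forall>\<^sub>F x in nhds q. P g x = 0) \<longleftrightarrow> (\<forall>\<^sub>F x in nhds p. P \<phi> x = 0)"
  proof (cases "phi_converges A (start j) p")
    case True
    then show ?thesis using that[of p \<phi>] \<phi> by (simp add: is_phi_def)
  next
    case False
    then obtain q g where "phi_sum A (start j) q g" "continues_to g q \<phi> p"
      using \<phi> by (auto simp: is_phi_def)
    then show ?thesis using that[of q g] weyl_continuation by blast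
  qed
  obtain \<epsilon>' L' K where \<epsilon>': "\<epsilon>' > 0" and L': "log_branch L' (ball q \<epsilon>')" and K: "K \<noteq> 0"
    and series: "\<forall>\<^sub>F x in nhds q. ann_op w g x = of_int (w $ j) * (K * monomial L' y0 x)"
    using ann_op_phi_sum[OF w j g] .
  show ?thesis
  proof
    assume "w $ j = 0"
    then have "\<forall>\<^sub>F x in nhds q. ann_op w g x = 0"
      using series by simp
    then have "\<forall>\<^sub>F x in nhds p. ann_op w \<phi> x = 0"
      using cont[OF weyl_ann_op] by blast
    then show "ann_op w \<phi> p = 0" by (rule eventually_nhds_x_imp_x)
  next
    assume zero: "ann_op w \<phi> p = 0"
    \<comment> \<open>Written as operators in \<open>weyl\<close> acting on the function itself, the
      eigenvalue equations become statements that \<open>cont\<close> can transport.\<close>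
    define E where "E k f x = x $ k * pd k (ann_op w f) x + (- y0 $ k) * ann_op w f x" for k f x
    have E: "E k \<in> weyl" for k
    proof -
      have "(\<lambda>f x. x $ k * (pd k \<circ> ann_op w) f x + (- y0 $ k) * ann_op w f x) \<in> weyl"
        by (intro weyl.add weyl_coordinate_mult weyl_cmult weyl.mult weyl.pd weyl_ann_op)
      then show ?thesis by (simp add: E_def[abs_def])
    qed
    have "\<forall>\<^sub>F x in nhds q. E k g x = 0" for k
    proof -
      define h where "h x = of_int (w $ j) * K * monomial L' y0 x" for x
      have "\<forall>\<^sub>F x in nhds q. ann_op w g x = h x"
        using series by (simp add: h_def mult.assoc)
      moreover from this have "\<forall>\<^sub>F x in nhds q. pd k (ann_op w g) x = pd k h x"
        by (rule weyl_local[OF weyl.pd])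
      moreover have "\<forall>\<^sub>F x in nhds q. x \<in> ball q \<epsilon>'"
        using \<epsilon>' by (intro eventually_nhds_in_open) auto
      ultimately show ?thesis
      proof eventually_elim
        case (elim x)
        have "pd k h x = of_int (w $ j) * K * pd k (monomial L' y0) x"
          unfolding h_def[abs_def] by (rule pd_cmult[OF sep_holomorphic_monomial[OF L'] elim(3)])
        then have "x $ k * pd k h x = y0 $ k * h x"
          using pd_monomial[OF L' open_ball elim(3), of k y0] by (simp add: h_def mult.left_commute)
        then show ?case using elim by (simp add: E_def)
      qed
    qed
    then have "\<forall>\<^sub>F x in nhds p. E k \<phi> x = 0" for k
      using cont[OF E] by blast
    then have "\<forall>\<^sub>F x in nhds p. \<forall>k\<in>UNIV. E k \<phi> x = 0"
      by (intro eventually_ball_finite) auto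
    moreover have "\<forall>\<^sub>F x in nhds p. x \<in> ball p r \<inter> ball p \<epsilon>"
      using r \<epsilon> by (intro eventually_nhds_in_open) auto
    ultimately have "\<forall>\<^sub>F x in nhds p. (\<forall>k. E k \<phi> x = 0) \<and> x \<in> ball p r \<inter> ball p \<epsilon>"
      by eventually_elim auto
    then obtain U where U: "open U" "p \<in> U"
      and eig: "\<And>x. x \<in> U \<Longrightarrow> (\<forall>k. E k \<phi> x = 0) \<and> x \<in> ball p r \<inter> ball p \<epsilon>"
      unfolding eventually_nhds by blast
    have "\<forall>\<^sub>F x in nhds p. ann_op w \<phi> x = 0"
    proof (rule euler_eigenfunction_zero[OF _ U, where y = y0 and L = L])
      show "log_branch L U" using eig by (intro log_branch_subset[OF L]) blast
      show "ann_op w \<phi> sep_holomorphic_on U"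
        using eig by (intro weyl_sep_holomorphic[OF weyl_ann_op _ U(1)] sep_holomorphic_on_subset[OF hol]) blast
      show "x $ k * pd k (ann_op w \<phi>) x = y0 $ k * ann_op w \<phi> x" if "x \<in> U" for x k
        using eig[OF that] by (simp add: E_def)
    qed (rule zero)
    then have "\<forall>\<^sub>F x in nhds q. ann_op w g x = 0"
      using cont[OF weyl_ann_op] by blast
    with series have "\<forall>\<^sub>F x in nhds q. of_int (w $ j) * (K * monomial L' y0 x) = 0"
      by eventually_elim simp
    then have "of_int (w $ j) * (K * monomial L' y0 q) = 0"
      by (rule eventually_nhds_x_imp_x)
    then show "w $ j = 0" using K by (simp add: monomial_nonzero)
  qed
qed

section \<open>The operators on the image of the derivative\<close>

lemma ann_op_pd_solution:
  assumes w: "w \<in> left_kernel" and U: "open U" and x: "x \<in> U"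
    and \<psi>: "\<psi> \<in> solutions U A (map_matrix of_int A *v v)"
  shows "ann_op w (pd_map U j3 \<psi>) x = 0"
proof -
  have hol: "\<psi> sep_holomorphic_on U"
    and ann: "\<And>P x. P \<in> hypergeometric_ideal A (map_matrix of_int A *v v) \<Longrightarrow> x \<in> U \<Longrightarrow> P \<psi> x = 0"
    using \<psi> mholomorphic_imp_sep_holomorphic unfolding solutions_def by auto
  obtain y :: "'d \<Rightarrow> int" where y: "\<And>k. w $ k = (\<Sum>i\<in>UNIV. y i * A $ i $ k)"
    using left_kernel_row_space[OF w] by blast
  have swap: "(\<Sum>k\<in>UNIV. of_int (w $ k) * f k) = (\<Sum>i\<in>UNIV. of_int (y i) * (\<Sum>k\<in>UNIV. of_int (A $ i $ k) * f k))"
    for f :: "'n \<Rightarrow> complex"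
    unfolding y of_int_sum sum_distrib_right sum_distrib_left
    by (subst sum.swap) (simp add: mult.assoc)
  have euler: "(\<Sum>k\<in>UNIV. of_int (w $ k) * (z $ k * pd k \<psi> z)) = (\<Sum>k\<in>UNIV. of_int (w $ k) * v $ k) * \<psi> z"
    if z: "z \<in> U" for z
  proof -
    have "(\<Sum>k\<in>UNIV. of_int (A $ i $ k) * (z $ k * pd k \<psi> z)) = (\<Sum>k\<in>UNIV. of_int (A $ i $ k) * v $ k) * \<psi> z" for i
      using ann[OF hypergeometric_ideal.euler z, of i]
      by (simp add: matrix_vector_mult_def map_matrix_def mult.assoc)
    then show ?thesis
      by (simp add: swap sum_distrib_right mult.assoc)
  qed
  have toric: "pd_monom (m i) (pd j3 \<psi>) x = pd i (pd_monom M \<psi>) x" if i: "i \<in> J" for i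
  proof -
    have diff: "int_vec (M + axis i 1) - int_vec (m i + axis j3 1) = \<delta> i"
      unfolding int_vec_add_axis int_vec_m[OF i] by (simp add: algebra_simps)
    have "A *v int_vec (M + axis i 1) - A *v int_vec (m i + axis j3 1) = 0"
      unfolding matrix_vector_mult_diff_distrib[symmetric] diff using \<Lambda>_\<delta>[of i] by (simp add: \<Lambda>_def)
    then have "A *v int_vec (M + axis i 1) = A *v int_vec (m i + axis j3 1)" by simp
    then have "pd_monom (M + axis i 1) \<psi> x = pd_monom (m i + axis j3 1) \<psi> x"
      using ann[OF hypergeometric_ideal.toric x] unfolding int_vec_def by simp
    then show ?thesis
      unfolding pd_monom_add_axis[OF hol U x] pd_monom_commute[OF hol U x] by simp
  qed
  have "ann_op w (pd_map U j3 \<psi>) x = ann_op w (pd j3 \<psi>) x"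
    by (rule weyl_cong[OF weyl_ann_op U _ x]) (simp add: pd_map_def)
  also have "\<dots> = (\<Sum>i\<in>J. of_int (w $ i) * (x $ i * pd i (pd_monom M \<psi>) x))"
    unfolding ann_op_def by (rule sum.cong) (simp_all add: toric)
  also have "\<dots> = (\<Sum>i\<in>UNIV. of_int (w $ i) * (x $ i * pd i (pd_monom M \<psi>) x))"
    using sum_left_kernel[OF w] by simp
  also have "\<dots> = ((\<Sum>k\<in>UNIV. of_int (w $ k) * v $ k) - (\<Sum>k\<in>UNIV. of_int (w $ k) * of_nat (M $ k))) * pd_monom M \<psi> x"
    by (rule euler_pd_monom[OF hol U euler x])
  also have "(\<Sum>k\<in>UNIV. of_int (w $ k) * v $ k) - (\<Sum>k\<in>UNIV. of_int (w $ k) * of_nat (M $ k))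
      = (\<Sum>k\<in>UNIV. of_int (w $ k) * y0 $ k)"
    by (simp add: y0_def cvec_def int_vec_def right_diff_distrib sum_subtractf)
  also have "\<dots> = 0"
    unfolding sum_left_kernel[OF w] by (rule sum.neutral) (simp add: y0_J)
  finally show ?thesis by simp
qed

section \<open>Two independent dependences\<close>

definition minor :: "'n \<Rightarrow> 'n \<Rightarrow> int" where
  "minor i k = B $ i $ 1 * B $ k $ 2 - B $ i $ 2 * B $ k $ 1"

text \<open>Cramer's rule for the linear dependence between the rows \<open>j\<close>, \<open>j3\<close>, \<open>j4\<close> of \<open>B\<close>.\<close>

definition dependence :: "'n \<Rightarrow> int^'n" where
  "dependence j = (\<chi> k. if k = j then minor j3 j4 else if k = j3 then minor j4 j
     else if k = j4 then minor j j3 else 0)"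

text \<open>This minor is the entry of \<open>dependence j\<close> at \<open>j\<close>; its
  positivity makes the diagonal values of the two functionals nonzero.\<close>

lemma minor_pos: "minor j3 j4 > 0"
proof -
  have "B $ j3 $ 1 * B $ j4 $ 2 > 0" "B $ j3 $ 2 * B $ j4 $ 1 < 0"
    using row3 row4 by (auto intro: mult_neg_neg mult_neg_pos)
  then show ?thesis by (simp add: minor_def)
qed

lemma dependence_left_kernel:
  assumes j: "j \<in> {j1, j2}"
  shows "dependence j \<in> left_kernel"
proof -
  have ne: "j \<noteq> j3" "j \<noteq> j4" "j3 \<noteq> j" "j4 \<noteq> j" using j distinct_J by auto
  have "(\<Sum>k\<in>UNIV. dependence j $ k * B $ k $ c) = 0" for c
  proof -
    have "(\<Sum>k\<in>UNIV. dependence j $ k * B $ k $ c) = (\<Sum>k\<in>{j, j3, j4}. dependence j $ k * B $ k $ c)"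
      by (rule sum.mono_neutral_right) (auto simp: dependence_def)
    also have "\<dots> = minor j3 j4 * B $ j $ c + minor j4 j * B $ j3 $ c + minor j j3 * B $ j4 $ c"
      using ne distinct_J by (simp add: dependence_def)
    \<comment> \<open>The expansion of a 3 by 3 determinant in which column \<open>c\<close> of
      \<open>B\<close> occurs twice.\<close>
    also have "\<dots> = 0"
      using exhaust_2[of c] by (auto simp: minor_def algebra_simps)
    finally show ?thesis .
  qed
  then show ?thesis
    using j unfolding left_kernel_def by (auto simp: dependence_def J_def)
qed

end


section \<open>Linear algebra\<close>

text \<open>If one \<open>t\<close> generated the span modulo \<open>W\<close>, then
  \<open>\<phi>1\<close> and \<open>\<phi>2\<close> would be multiples of \<open>t\<close> by
  \<open>a\<close> and \<open>b\<close>, modulo the common kernel of the functionals. As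
  \<open>l1 \<phi>1\<close> is nonzero, so is \<open>a\<close>; then \<open>l2 \<phi>1 = 0\<close>
  gives \<open>l2 t = 0\<close>, against \<open>l2 \<phi>2\<close> being nonzero. Linearity is
  required on \<open>V\<close> only, since differential operators are linear only where the
  derivatives exist.\<close>

lemma dim_bounds_of_functionals:
  fixes l1 l2 :: "('a \<Rightarrow> complex) \<Rightarrow> complex"
  assumes V: "cfun.subspace V"
    and lin1: "\<And>a b f g. f \<in> V \<Longrightarrow> g \<in> V \<Longrightarrow> l1 (cscale a f + cscale b g) = a * l1 f + b * l1 g"
    and lin2: "\<And>a b f g. f \<in> V \<Longrightarrow> g \<in> V \<Longrightarrow> l2 (cscale a f + cscale b g) = a * l2 f + b * l2 g"
    and W: "\<And>f. f \<in> W \<Longrightarrow> f \<in> V \<and> l1 f = 0 \<and> l2 f = 0"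
    and \<phi>: "{\<phi>1, \<phi>2, \<phi>3, \<phi>4} \<subseteq> V"
    and l: "l1 \<phi>1 \<noteq> 0" "l1 \<phi>2 = 0" "l2 \<phi>1 = 0" "l2 \<phi>2 \<noteq> 0"
  shows "cfun.dim (W \<inter> cfun.span {\<phi>1, \<phi>2, \<phi>3, \<phi>4}) \<le> 2"
    and "dim_mod (cfun.span {\<phi>1, \<phi>2, \<phi>3, \<phi>4}) W \<ge> 2"
    and "cscale a \<phi>1 + cscale b \<phi>2 \<in> W \<Longrightarrow> a = 0 \<and> b = 0"
proof -
  define S where "S = cfun.span {\<phi>1, \<phi>2, \<phi>3, \<phi>4}"
  have SV: "S \<subseteq> V" unfolding S_def using \<phi> V by (rule cfun.span_minimal)
  have \<phi>V: "\<phi>1 \<in> V" "\<phi>2 \<in> V" "\<phi>3 \<in> V" "\<phi>4 \<in> V" using \<phi> by auto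
  note clos = cfun.subspace_add[OF V] cfun.subspace_scale[OF V]
  show "a = 0 \<and> b = 0" if "cscale a \<phi>1 + cscale b \<phi>2 \<in> W"
    using W[OF that] lin1[OF \<phi>V(1,2), of a b] lin2[OF \<phi>V(1,2), of a b] l by simp
  \<comment> \<open>\<open>g\<close> projects onto the common kernel along \<open>\<phi>1\<close>
    and \<open>\<phi>2\<close>, which it maps to 0; so the part of \<open>S\<close> in that kernel
    is spanned by the images of \<open>\<phi>3\<close> and \<open>\<phi>4\<close>.\<close>
  define g where "g \<phi> = cscale 1 \<phi> + cscale (- 1) (cscale (l1 \<phi> / l1 \<phi>1) \<phi>1 + cscale (l2 \<phi> / l2 \<phi>2) \<phi>2)" for \<phi>
  have "W \<inter> S \<subseteq> cfun.span {g \<phi>3, g \<phi>4}"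
  proof
    fix f assume f: "f \<in> W \<inter> S"
    then have "f \<in> S" by blast
    then obtain c1 c2 c3 c4 where "f - cscale c1 \<phi>1 - cscale c2 \<phi>2 - cscale c3 \<phi>3 - cscale c4 \<phi>4 = 0"
      unfolding S_def by (auto simp: cfun.span_insert)
    then have f_eq: "f = cscale 1 (cscale c1 \<phi>1 + cscale c2 \<phi>2) + cscale 1 (cscale c3 \<phi>3 + cscale c4 \<phi>4)"
      by (simp add: algebra_simps)
    have "l1 f = c1 * l1 \<phi>1 + (c3 * l1 \<phi>3 + c4 * l1 \<phi>4)" "l2 f = c2 * l2 \<phi>2 + (c3 * l2 \<phi>3 + c4 * l2 \<phi>4)"
      unfolding f_eq using l by (simp_all only: lin1 lin2 clos \<phi>V) simp_all
    moreover have "l1 f = 0" "l2 f = 0" using W f by auto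
    ultimately have c: "c1 = - (c3 * (l1 \<phi>3 / l1 \<phi>1) + c4 * (l1 \<phi>4 / l1 \<phi>1))"
      "c2 = - (c3 * (l2 \<phi>3 / l2 \<phi>2) + c4 * (l2 \<phi>4 / l2 \<phi>2))"
      using l by (simp_all add: field_simps eq_neg_iff_add_eq_0)
    have "f = cscale c3 (g \<phi>3) + cscale c4 (g \<phi>4)"
      unfolding f_eq g_def c by (simp add: fun_eq_iff cscale_def algebra_simps del: times_divide_eq_right)
    also have "\<dots> \<in> cfun.span {g \<phi>3, g \<phi>4}"
      by (intro cfun.span_add cfun.span_scale cfun.span_base) auto
    finally show "f \<in> cfun.span {g \<phi>3, g \<phi>4}" .
  qed
  then have "cfun.dim (W \<inter> S) \<le> card {g \<phi>3, g \<phi>4}"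
    by (rule cfun.dim_le_card) simp
  also have "\<dots> \<le> 2" by (simp add: card_insert_if)
  finally show "cfun.dim (W \<inter> cfun.span {\<phi>1, \<phi>2, \<phi>3, \<phi>4}) \<le> 2" by (simp add: S_def)
  \<comment> \<open>The minimum in \<open>dim_mod\<close> is attained once some finite generating
    set exists; the four functions form one.\<close>
  have "\<exists>T. finite T \<and> card T = card {\<phi>1, \<phi>2, \<phi>3, \<phi>4} \<and> T \<subseteq> S \<and> S \<subseteq> cfun.span (T \<union> W)"
  proof (intro exI[of _ "{\<phi>1, \<phi>2, \<phi>3, \<phi>4}"] conjI)
    show "{\<phi>1, \<phi>2, \<phi>3, \<phi>4} \<subseteq> S" unfolding S_def by (rule cfun.span_superset)
    show "S \<subseteq> cfun.span ({\<phi>1, \<phi>2, \<phi>3, \<phi>4} \<union> W)" unfolding S_def by (intro cfun.span_mono) auto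
  qed auto
  from LeastI[of "\<lambda>k. \<exists>T. finite T \<and> card T = k \<and> T \<subseteq> S \<and> S \<subseteq> cfun.span (T \<union> W)", OF this]
  obtain T where T: "finite T" "card T = dim_mod S W" "T \<subseteq> S" "S \<subseteq> cfun.span (T \<union> W)"
    unfolding dim_mod_def by blast
  have "\<not> card T < 2"
  proof
    assume "card T < 2"
    have \<phi>S: "\<phi>1 \<in> S" "\<phi>2 \<in> S" unfolding S_def by (auto intro: cfun.span_base)
    obtain t where t: "t \<in> S" "T \<subseteq> {t}"
    proof (cases "T = {}")
      case False
      then have "card T = 1" using \<open>card T < 2\<close> T(1) card_gt_0_iff[of T] by linarith
      then show thesis using that T(3) by (metis card_1_singletonE insert_subset subset_refl)
    qed (use that \<phi>S in blast)
    \<comment> \<open>\<open>dim_mod\<close> works modulo the span of \<open>W\<close>, so vanishing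
      on \<open>W\<close> is extended to its span through this subspace.\<close>
    define K where "K = {f \<in> V. l1 f = 0 \<and> l2 f = 0}"
    have "cfun.subspace K"
    proof (rule cfun.subspaceI)
      show "0 \<in> K"
        using cfun.subspace_0[OF V] lin1[OF \<phi>V(1,1), of 0 0] lin2[OF \<phi>V(1,1), of 0 0] by (simp add: K_def)
      show "f + h \<in> K" if "f \<in> K" "h \<in> K" for f h
        using that lin1[of f h 1 1] lin2[of f h 1 1] clos(1)[of f h] by (simp add: K_def)
      show "cscale c f \<in> K" if "f \<in> K" for c f
        using that lin1[of f f c 0] lin2[of f f c 0] clos(2)[of f c] by (simp add: K_def)
    qed
    then have WK: "cfun.span W \<subseteq> K"
      using W by (intro cfun.span_minimal) (auto simp: K_def)
    have "S \<subseteq> cfun.span (insert t W)"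
      using T(4) t(2) cfun.span_mono[of "T \<union> W" "insert t W"] by blast
    then obtain a b where "\<phi>1 - cscale a t \<in> K" "\<phi>2 - cscale b t \<in> K"
      using \<phi>S WK unfolding cfun.span_insert by blast
    moreover have tV: "t \<in> V" using t SV by blast
    ultimately have "l1 \<phi>1 = a * l1 t" "0 = a * l2 t" "l2 \<phi>2 = b * l2 t"
      using lin1[OF \<phi>V(1) tV, of 1 "- a"] lin2[OF \<phi>V(1) tV, of 1 "- a"] lin2[OF \<phi>V(2) tV, of 1 "- b"] l
      by (simp_all add: K_def)
    with l show False by auto
  qed
  then show "dim_mod (cfun.span {\<phi>1, \<phi>2, \<phi>3, \<phi>4}) W \<ge> 2"
    using T(2) by (simp add: S_def)
qed

lemma subspace_sep_holomorphic: "cfun.subspace {f. f sep_holomorphic_on U}"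
  by (rule cfun.subspaceI)
     (auto simp: zero_fun_def plus_fun_def cscale_def
       intro: sep_holomorphic_const sep_holomorphic_add sep_holomorphic_cmult)


section \<open>Evaluation at \<open>p\<close> and conclusion\<close>

theorem theorem4p6:
  fixes A :: "int^'n::finite^'d::finite" and B :: "int^2^'n"
    and i\<^sub>0 :: 'd and j1 j2 j3 j4 :: 'n
    and \<alpha> v p :: "complex^'n" and \<beta> :: "complex^'d" and r :: real
    and \<phi>1 \<phi>2 \<phi>3 \<phi>4 :: "complex^'n \<Rightarrow> complex"
  assumes rank: "rank (map_matrix real_of_int A) = CARD('d)"
    and codim: "CARD('n) = CARD('d) + 2"
    and ones: "\<And>j. A $ i\<^sub>0 $ j = 1"
    and cols: "\<And>y. \<exists>u. A *v u = y"
    and basis: "bij_betw (\<lambda>z. B *v z) UNIV {u. A *v u = 0}"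
    and indices: "distinct [j1, j2, j3, j4]"
    and row1: "B $ j1 $ 1 > 0" "B $ j1 $ 2 > 0"
    and row2: "B $ j2 $ 1 < 0" "B $ j2 $ 2 > 0"
    and row3: "B $ j3 $ 1 < 0" "B $ j3 $ 2 < 0"
    and row4: "B $ j4 $ 1 > 0" "B $ j4 $ 2 < 0"
    and cone: "(\<forall>a b :: real. a *s row j2 (map_matrix real_of_int B)
                  + b *s row j4 (map_matrix real_of_int B) = 0 \<longrightarrow> a = 0 \<and> b = 0) \<Longrightarrow>
       {z :: real^2. (map_matrix real_of_int B *v z) $ j2 \<ge> 0 \<and> (map_matrix real_of_int B *v z) $ j4 \<ge> 0}
         \<subseteq> {z. z $ 1 \<ge> 0 \<and> z $ 2 \<ge> 0}"
    and irrational: "\<And>i. i \<notin> {j1, j2, j3, j4} \<Longrightarrow> \<alpha> $ i \<notin> \<rat>"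
    and generic: "\<And>i. i \<notin> {j1, j2, j3, j4} \<Longrightarrow>
       \<alpha> $ i \<notin> rat_adjoin {\<alpha> $ j | j. j \<notin> {j1, j2, j3, j4} \<and> j \<noteq> i}"
    and v: "v = cvec (pos_part (column 1 B) + pos_part (column 2 B))
               - axis j1 1 - axis j2 1 - axis j4 1
               + (\<chi> i. if i \<in> {j1, j2, j3, j4} then 0 else \<alpha> $ i)"
    and \<beta>: "\<beta> = map_matrix of_int A *v (v - axis j3 1)"
    and r: "r > 0"
    (* If two opposite rows of B are parallel, then two opposite series have no common domain of
       convergence; they are then related by analytic continuation. *)
    and point: "phi_converges A (v - axis j3 1 - cvec (column 1 B) - cvec (column 2 B)) p \<or>
                phi_converges A (v - axis j3 1) p"
               "phi_converges A (v - axis j3 1 - cvec (column 2 B)) p \<or>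
                phi_converges A (v - axis j3 1 - cvec (column 1 B)) p"
    and sol: "{\<phi>1, \<phi>2, \<phi>3, \<phi>4} \<subseteq> solutions (ball p r) A \<beta>"
    and \<phi>1: "is_phi A (v - axis j3 1 - cvec (column 1 B) - cvec (column 2 B)) p \<phi>1"
    and \<phi>2: "is_phi A (v - axis j3 1 - cvec (column 2 B)) p \<phi>2"
    and \<phi>3: "is_phi A (v - axis j3 1) p \<phi>3"
    and \<phi>4: "is_phi A (v - axis j3 1 - cvec (column 1 B)) p \<phi>4"
  shows "let S = cfun.span {\<phi>1, \<phi>2, \<phi>3, \<phi>4};
             Img = pd_map (ball p r) j3 ` solutions (ball p r) A (map_matrix of_int A *v v)
         in cfun.dim (Img \<inter> S) \<le> 2 \<and>
            dim_mod S Img \<ge> 2 \<and>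
            (\<exists>g1 g2. g1 \<in> S \<and> g2 \<in> S \<and> {g1, g2} \<subseteq> solutions (ball p r) A \<beta> \<and>
               (\<forall>a b. cscale a g1 + cscale b g2 \<in> Img \<longrightarrow> a = 0 \<and> b = 0))"
proof -
  interpret c: codim_two A B j1 j2 j3 j4 \<alpha>
    by unfold_locales (fact cols basis indices row1 row2 row3 row4 irrational)+
  have v_eq: "c.v = v"
    unfolding c.v_def c.v_int_def c.J_def v by simp
  have start1: "v - axis j3 1 - cvec (column 1 B) - cvec (column 2 B) = c.start j1"
    and start2: "v - axis j3 1 - cvec (column 2 B) = c.start j2"
    using c.distinct_J by (simp_all add: c.start_def c.\<delta>_def v_eq algebra_simps)
  define V where "V = {f. f sep_holomorphic_on ball p r}"
  define Img where "Img = pd_map (ball p r) j3 ` solutions (ball p r) A (map_matrix of_int A *v v)"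
  define l where "l j f = c.ann_op (c.dependence j) f p" for j f
  have p: "p \<in> ball p r" using r by simp
  \<comment> \<open>A series convergent at \<open>p\<close> comes with logarithms of all coordinates
    near \<open>p\<close>.\<close>
  obtain L \<epsilon> where L: "log_branch L (ball p \<epsilon>)" and \<epsilon>: "\<epsilon> > 0"
    using point(1) phi_sum_normal_series unfolding phi_converges_def normal_series_def by metis
  have \<phi>V: "{\<phi>1, \<phi>2, \<phi>3, \<phi>4} \<subseteq> V"
    using sol mholomorphic_imp_sep_holomorphic unfolding solutions_def V_def by auto
  have lin: "l j (cscale a f + cscale b g) = a * l j f + b * l j g" if "f \<in> V" "g \<in> V" for j a b f g
    using weyl_lincomb[OF c.weyl_ann_op _ _ open_ball p, of f g] that
    by (simp add: l_def V_def cscale_def plus_fun_def)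
  have Img: "f \<in> V \<and> l j1 f = 0 \<and> l j2 f = 0" if "f \<in> Img" for f
  proof -
    obtain \<psi> where \<psi>: "\<psi> \<in> solutions (ball p r) A (map_matrix of_int A *v v)"
      and f: "f = pd_map (ball p r) j3 \<psi>"
      using \<open>f \<in> Img\<close> unfolding Img_def by blast
    have "\<psi> sep_holomorphic_on ball p r"
      using \<psi> mholomorphic_imp_sep_holomorphic unfolding solutions_def by blast
    then have "f \<in> V"
      unfolding V_def f mem_Collect_eq
      by (rule sep_holomorphic_on_cong[OF sep_holomorphic_pd[OF _ open_ball, of \<psi> p r j3] open_ball])
        (auto simp: pd_map_def)
    moreover have "l j f = 0" if "j \<in> {j1, j2}" for j
      unfolding l_def f
      by (rule c.ann_op_pd_solution[OF c.dependence_left_kernel[OF that] open_ball p]) (use \<psi> v_eq in simp)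
    ultimately show ?thesis by simp
  qed
  have l_phi: "l j f = 0 \<longleftrightarrow> c.dependence j $ k = 0"
    if "j \<in> {j1, j2}" "k \<in> {j1, j2}" "is_phi A (c.start k) p f" "f \<in> V" for j k f
    unfolding l_def
    using that c.ann_op_is_phi[OF c.dependence_left_kernel _ _ _ r L \<epsilon>] by (auto simp: c.J_def V_def)
  have \<phi>: "is_phi A (c.start j1) p \<phi>1" "is_phi A (c.start j2) p \<phi>2" "\<phi>1 \<in> V" "\<phi>2 \<in> V"
    using \<phi>1 \<phi>2 \<phi>V by (simp_all add: start1 start2)
  \<comment> \<open>\<open>dependence j1\<close> vanishes at \<open>j2\<close> and vice versa, so
    the 2 by 2 matrix of values is diagonal, with nonzero diagonal by
    \<open>minor_pos\<close>.\<close>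
  have l_values: "l j1 \<phi>1 \<noteq> 0" "l j1 \<phi>2 = 0" "l j2 \<phi>1 = 0" "l j2 \<phi>2 \<noteq> 0"
    using l_phi[OF _ _ \<phi>(1,3)] l_phi[OF _ _ \<phi>(2,4)] c.minor_pos c.distinct_J
    by (auto simp: c.dependence_def)
  note bounds = dim_bounds_of_functionals[where V = V and W = Img and ?l1.0 = "l j1" and ?l2.0 = "l j2",
      OF subspace_sep_holomorphic[of "ball p r", folded V_def] lin lin Img \<phi>V l_values]
  have "\<phi>1 \<in> cfun.span {\<phi>1, \<phi>2, \<phi>3, \<phi>4} \<and> \<phi>2 \<in> cfun.span {\<phi>1, \<phi>2, \<phi>3, \<phi>4} \<and>
      {\<phi>1, \<phi>2} \<subseteq> solutions (ball p r) A \<beta> \<and>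
      (\<forall>a b. cscale a \<phi>1 + cscale b \<phi>2 \<in> Img \<longrightarrow> a = 0 \<and> b = 0)"
    using sol bounds(3) by (auto intro: cfun.span_base)
  then show ?thesis
    unfolding Let_def Img_def[symmetric] using bounds(1,2) by blast
qed

end
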